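(* Assume $N_j>2n_j$ for $j=1,\dots,d$, and fix $\Psi:\mathbb{T}^d_{\mathbf N}\to\mathfrak{H}_{+,m}$. Then the map $$\omega:\mathscr{L}_+\to\mathscr{M}_+,\qquad \omega(\mathbf Q)=\Gamma\big((\Psi^{-1}+Q)^{-1}\big)=\left\{\int_{\mathbb{T}^d}e^{i\langle\mathbf k,\boldsymbol\theta\rangle}(\Psi^{-1}+Q)^{-1}\,\mathrm{d}\nu_{\mathbf N}\right\}_{\mathbf k\in\Lambda}$$ is a diffeomorphism (a $C^\infty$ bijection with $C^\infty$ inverse).
   Context: Let $d,m\ge1$ be integers. $\mathfrak{H}_{+,m}$ is the set of $m\times m$ Hermitian positive definite complex matrices; $X>0$ means Hermitian positive definite; $(\cdot)^*$ is conjugate transpose. Fix positive integers $\mathbf N=(N_1,\dots,N_d)$, put $|\mathbf N|=\prod_j N_j$ and $\mathbb{Z}^d_{\mathbf N}=\{\boldsymbol\ell\in\mathbb{Z}^d:0\le\ell_j\le N_j-1,\ j=1,\dots,d\}$. The grid is $\mathbb{T}^d_{\mathbf N}=\{(2\pi\ell_1/N_1,\dots,2\pi\ell_d/N_d):\boldsymbol\ell\in\mathbb{Z}^d_{\mathbf N}\}$, and $\boldsymbol\zeta_{\boldsymbol\ell}=(e^{i2\pi\ell_1/N_1},\dots,e^{i2\pi\ell_d/N_d})$; functions on the grid are written interchangeably as functions of $\boldsymbol\theta$, of $e^{i\boldsymbol\theta}$, or of $\boldsymbol\zeta_{\boldsymbol\ell}$. Integrals against $\nu_{\mathbf N}$ are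 the averages $\int_{\mathbb{T}^d}f(e^{i\boldsymbol\theta})\,\mathrm{d}\nu_{\mathbf N}=\frac1{|\mathbf N|}\sum_{\boldsymbol\ell\in\mathbb{Z}^d_{\mathbf N}}f(\boldsymbol\zeta_{\boldsymbol\ell})$. $\langle\mathbf k,\boldsymbol\theta\rangle=\sum_jk_j\theta_j$. $\Lambda\subset\mathbb{Z}^d$ is a finite index set with $\mathbf 0\in\Lambda$ and $-\mathbf k\in\Lambda$ whenever $\mathbf k\in\Lambda$; $n_j:=\max\{|k_j|:\mathbf k\in\Lambda\}$. $\mathbf Q$ ranges over the finite-dimensional real vector space of families $\{Q_{\mathbf k}\}_{\mathbf k\in\Lambda}$ with $Q_{\mathbf k}\in\mathbb{C}^{m\times m}$ and $Q_{-\mathbf k}=Q_{\mathbf k}^*$, with associated polynomial $Q(e^{i\boldsymbol\theta})=\sum_{\mathbf k\in\Lambda}Q_{\mathbf k}e^{-i\langle\mathbf k,\boldsymbol\theta\rangle}$. $\mathscr{L}_+=\{\mathbf Q:(\Psi^{-1}+Q)(\boldsymbol\zeta_{\boldsymbol\ell})>0\ \ \forall\boldsymbol\ell\in\mathbb{Z}^d_{\mathbf N}\}$. For a Hermitian-matrix-valued function $\Phi$ on $\mathbb{T}^d_{\mathbf N}$, $\Gamma(\Phi)=\{\int_{\mathbb{T}^d}e^{i\langle\mathbf k,\boldsymbol\theta\rangle}\Phi\,\mathrm{d}\nu_{\mathbf N}\}_{\mathbf k\in\Lambda}$, and $\mathscr{M}_+=\{\Gamma(\Phi):\Phi(\boldsymbol\zeta_{\boldsymbol\ell})>0\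 \ \forall\boldsymbol\ell\in\mathbb{Z}^d_{\mathbf N}\}$, a subset of the finite-dimensional real vector space of families $\{\Sigma_{\mathbf k}\}_{\mathbf k\in\Lambda}$ of $m\times m$ complex matrices with $\Sigma_{-\mathbf k}=\Sigma_{\mathbf k}^*$. *)

theory Defs
  imports "HOL-Analysis.Analysis"
begin

section \<open>Complex matrices\<close>

definition ctranspose :: "complex^'n^'m \<Rightarrow> complex^'m^'n" where
  "ctranspose A = (\<chi> i j. cnj (A $ j $ i))"

text \<open>The form \<open>x\<^sup>* A x\<close> is real for Hermitian \<open>A\<close>, so taking its real part loses nothing.\<close>

definition herm_posdef :: "complex^'m^'m \<Rightarrow> bool" where
  "herm_posdef A \<longleftrightarrow> ctranspose A = A \<and>
     (\<forall>x. x \<noteq> 0 \<longrightarrow> 0 < Re (\<Sum>i\<in>UNIV. cnj (x $ i) * (A *v x) $ i))"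

definition mscale :: "complex \<Rightarrow> complex^'n^'m \<Rightarrow> complex^'n^'m" where
  "mscale c A = (\<chi> i j. c * A $ i $ j)"

section \<open>Smooth maps between open subsets of real subspaces\<close>

text \<open>
  \<open>S\<close> is meant to be open relative to the subspace \<open>V\<close>. The derivative at \<open>x\<close> within \<open>S\<close> is
  then uniquely determined on \<open>V\<close> (but not off \<open>V\<close>), which is why only directions in \<open>V\<close> are
  followed up. As \<open>V\<close> will be finite-dimensional, \<open>x \<mapsto> Df(x)\<close> is \<open>C\<^sup>n\<close> as a map into the
  linear maps on \<open>V\<close> iff \<open>x \<mapsto> Df(x)v\<close> is \<open>C\<^sup>n\<close> for every \<open>v \<in> V\<close>.
\<close>

primrec Ck_on :: "nat \<Rightarrow> 'a::real_normed_vector set \<Rightarrow> 'a set \<Rightarrow> ('a \<Rightarrow> 'b::real_normed_vector) \<Rightarrow> bool" where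
  "Ck_on 0 V S f \<longleftrightarrow> continuous_on S f"
| "Ck_on (Suc n) V S f \<longleftrightarrow>
     (\<exists>f'. (\<forall>x\<in>S. (f has_derivative f' x) (at x within S)) \<and> (\<forall>v\<in>V. Ck_on n V S (\<lambda>x. f' x v)))"

definition smooth_map_on :: "'a::real_normed_vector set \<Rightarrow> 'a set \<Rightarrow> ('a \<Rightarrow> 'b::real_normed_vector) \<Rightarrow> bool" where
  "smooth_map_on V S f \<longleftrightarrow> (\<forall>n. Ck_on n V S f)"

definition diffeomorphism_between ::
  "'a::real_normed_vector set \<Rightarrow> 'a set \<Rightarrow> 'b::real_normed_vector set \<Rightarrow> 'b set \<Rightarrow> ('a \<Rightarrow> 'b) \<Rightarrow> bool" where
  "diffeomorphism_between V S W T f \<longleftrightarrow>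
     subspace V \<and> openin (top_of_set V) S \<and>
     subspace W \<and> openin (top_of_set W) T \<and>
     bij_betw f S T \<and> smooth_map_on V S f \<and> smooth_map_on W T (inv_into S f)"

section \<open>The grid and its averages\<close>

definition grid_index :: "nat^'d \<Rightarrow> (int^'d) set" where
  "grid_index N = {l. \<forall>j. 0 \<le> l $ j \<and> l $ j \<le> int (N $ j) - 1}"

text \<open>Functions on the grid are taken as functions of the angle vector \<open>\<theta>\<close>; only their values at
  the points \<open>grid_point N l\<close> with \<open>l \<in> grid_index N\<close> matter.\<close>

definition grid_point :: "nat^'d \<Rightarrow> int^'d \<Rightarrow> real^'d" where
  "grid_point N l = (\<chi> j. 2 * pi * of_int (l $ j) / of_nat (N $ j))"

definition grid_average :: "nat^'d \<Rightarrow> (real^'d \<Rightarrow> 'a::real_vector) \<Rightarrow> 'a" where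
  "grid_average N f = (1 / real (\<Prod>j\<in>UNIV. N $ j)) *\<^sub>R (\<Sum>l\<in>grid_index N. f (grid_point N l))"

definition freq_pairing :: "int^'d \<Rightarrow> real^'d \<Rightarrow> real" where
  "freq_pairing k \<theta> = (\<Sum>j\<in>UNIV. of_int (k $ j) * \<theta> $ j)"

section \<open>Matrix families indexed by a finite frequency set\<close>

text \<open>
  A family \<open>(Q\<^sub>k)\<close> over a finite \<open>\<Lambda> \<subseteq> \<int>\<^sup>d\<close> is a vector over a finite type \<open>'k\<close> that enumerates
  \<open>\<Lambda>\<close> through a bijection \<open>idx :: 'k \<Rightarrow> int^'d\<close>: the component at \<open>a\<close> is \<open>Q\<^sub>k\<close> with \<open>k = idx a\<close>.
  This makes the families elements of a Euclidean space.
\<close>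

definition herm_families :: "('k \<Rightarrow> int^'d) \<Rightarrow> (complex^'m^'m^'k) set" where
  "herm_families idx = {Q. \<forall>a b. idx b = - idx a \<longrightarrow> Q $ b = ctranspose (Q $ a)}"

definition trig_poly :: "('k::finite \<Rightarrow> int^'d) \<Rightarrow> complex^'m^'m^'k \<Rightarrow> real^'d \<Rightarrow> complex^'m^'m" where
  "trig_poly idx Q \<theta> = (\<Sum>a\<in>UNIV. mscale (exp (- (\<i> * of_real (freq_pairing (idx a) \<theta>)))) (Q $ a))"

definition moments ::
  "('k::finite \<Rightarrow> int^'d) \<Rightarrow> nat^'d \<Rightarrow> (real^'d \<Rightarrow> complex^'m^'m) \<Rightarrow> complex^'m^'m^'k" where
  "moments idx N \<Phi> =
     (\<chi> a. grid_average N (\<lambda>\<theta>. mscale (exp (\<i> * of_real (freq_pairing (idx a) \<theta>))) (\<Phi> \<theta>)))"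

definition L_plus ::
  "('k::finite \<Rightarrow> int^'d) \<Rightarrow> nat^'d \<Rightarrow> (real^'d \<Rightarrow> complex^'m^'m) \<Rightarrow> (complex^'m^'m^'k) set" where
  "L_plus idx N \<Psi> = {Q \<in> herm_families idx. \<forall>l\<in>grid_index N.
     herm_posdef (matrix_inv (\<Psi> (grid_point N l)) + trig_poly idx Q (grid_point N l))}"

definition M_plus :: "('k::finite \<Rightarrow> int^'d) \<Rightarrow> nat^'d \<Rightarrow> (complex^'m^'m^'k) set" where
  "M_plus idx N = {moments idx N \<Phi> | \<Phi>. \<forall>l\<in>grid_index N. herm_posdef (\<Phi> (grid_point N l))}"

definition omega ::
  "('k::finite \<Rightarrow> int^'d) \<Rightarrow> nat^'d \<Rightarrow> (real^'d \<Rightarrow> complex^'m^'m) \<Rightarrow> complex^'m^'m^'k \<Rightarrow> complex^'m^'m^'k" where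
  "omega idx N \<Psi> Q = moments idx N (\<lambda>\<theta>. matrix_inv (matrix_inv (\<Psi> \<theta>) + trig_poly idx Q \<theta>))"

end

theory Submission imports Defs begin

text \<open>
  Evaluation of \<open>Q\<close> on the grid is adjoint to \<open>\<Gamma>\<close> up to the factor \<open>1/|N|\<close>, and it is inverted by
  \<open>\<Gamma>\<close> because the characters \<open>e\<^sup>i\<^sup>\<langle>\<^sup>k\<^sup>,\<^sup>\<theta>\<^sup>\<rangle>\<close>, \<open>k \<in> \<Lambda>\<close>, are orthogonal on the grid
  (this is where \<open>N\<^sub>j > 2n\<^sub>j\<close> enters). With \<open>A\<^sub>Q = \<Psi>\<^sup>-\<^sup>1 + Q\<close> the resolvent identity gives
  \<open>\<omega>(Q) - \<omega>(Q') = L(Q - Q')\<close> where \<open>L v = -\<Gamma>(A\<^sub>Q\<^sup>-\<^sup>1 v A\<^sub>Q\<^sub>'\<^sup>-\<^sup>1)\<close>. This operator is negative definite, as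
  \<open>Re tr(D\<^sup>* R D S) > 0\<close> for \<open>R, S > 0\<close> and \<open>D \<noteq> 0\<close>. Hence \<open>\<omega>\<close> is injective, by invariance of domain it
  is open, and its inverse \<open>G\<close> has derivative \<open>L\<^sup>-\<^sup>1\<close> at \<open>Q = Q' = G(y)\<close>; since \<open>L\<^sup>-\<^sup>1\<close> is built from \<open>G\<close>
  by smooth operations, \<open>G\<close> is smooth by bootstrapping. A compactness argument shows that the image is
  closed in the convex, hence connected, set of target moments, so \<open>\<omega>\<close> is onto.
\<close>

section \<open>Calculus of smooth maps\<close>

lemma Ck_on_SucD: "Ck_on (Suc n) V S f \<Longrightarrow> Ck_on n V S f"
proof (induction n arbitrary: f)
  case 0
  then show ?case
    by (auto intro: has_derivative_continuous_on)
next
  case (Suc n)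
  then show ?case unfolding Ck_on.simps(2) by blast
qed

lemma Ck_on_imp_continuous_on: "Ck_on n V S f \<Longrightarrow> continuous_on S f"
  proof (induction n)
  case (Suc n)
  then show ?case by (blast dest: Ck_on_SucD)
qed simp

lemma Ck_on_const: "Ck_on n V S (\<lambda>x. c)"
  by (induction n arbitrary: c) (auto intro!: exI[where x = "\<lambda>_ _. 0"] continuous_on_const has_derivative_const)

lemma Ck_on_ident: "Ck_on n V S (\<lambda>x. x)"
  by (cases n) (auto intro!: exI[where x = "\<lambda>_ v. v"] continuous_on_id has_derivative_ident Ck_on_const)

lemma Ck_on_bounded_linear:
  assumes "bounded_linear h" and "Ck_on n V S f"
  shows "Ck_on n V S (\<lambda>x. h (f x))"
  using assms(2)
proof (induction n arbitrary: f)
  case 0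
  then show ?case by (simp add: assms(1) bounded_linear.continuous_on)
next
  case (Suc n)
  then obtain f' where "\<And>x. x \<in> S \<Longrightarrow> (f has_derivative f' x) (at x within S)"
    "\<And>v. v \<in> V \<Longrightarrow> Ck_on n V S (\<lambda>x. f' x v)" by auto
  then show ?case using Suc.IH
    by (auto intro!: exI[where x = "\<lambda>x v. h (f' x v)"] bounded_linear.has_derivative[OF assms(1)])
qed

lemma Ck_on_add:
  assumes "Ck_on n V S f" and "Ck_on n V S g"
  shows "Ck_on n V S (\<lambda>x. f x + g x)"
  using assms
proof (induction n arbitrary: f g)
  case 0
  then show ?case by (simp add: continuous_on_add)
next
  case (Suc n)
  obtain f' where "\<And>x. x \<in> S \<Longrightarrow> (f has_derivative f' x) (at x within S)"
    "\<And>v. v \<in> V \<Longrightarrow> Ck_on n V S (\<lambda>x. f' x v)" using Suc.prems(1) by auto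
  moreover obtain g' where "\<And>x. x \<in> S \<Longrightarrow> (g has_derivative g' x) (at x within S)"
    "\<And>v. v \<in> V \<Longrightarrow> Ck_on n V S (\<lambda>x. g' x v)" using Suc.prems(2) by auto
  ultimately show ?case using Suc.IH
    by (auto intro!: exI[where x = "\<lambda>x v. f' x v + g' x v"] has_derivative_add)
qed

lemma Ck_on_sum:
  assumes "\<And>i. i \<in> I \<Longrightarrow> Ck_on n V S (f i)"
  shows "Ck_on n V S (\<lambda>x. \<Sum>i\<in>I. f i x)"
  using assms
  by (induction I rule: infinite_finite_induct) (auto intro!: Ck_on_const Ck_on_add)

lemma Ck_on_bounded_bilinear:
  assumes "bounded_bilinear h" and "Ck_on n V S f" and "Ck_on n V S g"
  shows "Ck_on n V S (\<lambda>x. h (f x) (g x))"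
  using assms(2,3)
proof (induction n arbitrary: f g)
  case 0
  then show ?case by (simp add: assms(1) bounded_bilinear.continuous_on)
next
  case (Suc n)
  obtain f' where "\<And>x. x \<in> S \<Longrightarrow> (f has_derivative f' x) (at x within S)"
    "\<And>v. v \<in> V \<Longrightarrow> Ck_on n V S (\<lambda>x. f' x v)" using Suc.prems(1) by auto
  moreover obtain g' where "\<And>x. x \<in> S \<Longrightarrow> (g has_derivative g' x) (at x within S)"
    "\<And>v. v \<in> V \<Longrightarrow> Ck_on n V S (\<lambda>x. g' x v)" using Suc.prems(2) by auto
  ultimately show ?case using Suc.IH Suc.prems[THEN Ck_on_SucD]
    by (auto intro!: exI[where x = "\<lambda>x v. h (f x) (g' x v) + h (f' x v) (g x)"] Ck_on_add
        bounded_bilinear.FDERIV[OF assms(1)])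
qed

text \<open>An operator on a finite-dimensional space is the finite sum of its values at basis
  vectors times the coordinate functionals, so smoothness of those values suffices.\<close>

lemma Ck_on_blinfunI:
  fixes f :: "'a::real_normed_vector \<Rightarrow> 'b::euclidean_space \<Rightarrow>\<^sub>L 'c::real_normed_vector"
  assumes "\<And>b. b \<in> Basis \<Longrightarrow> Ck_on n V S (\<lambda>x. f x b)"
  shows "Ck_on n V S f"
proof -
  have eq: "f = (\<lambda>x. \<Sum>b\<in>Basis. blinfun_scaleR_left (f x b) o\<^sub>L blinfun_inner_left b)"
    by (intro ext blinfun_eqI)
       (simp add: blinfun.sum_left blinfun.scaleR_right[symmetric] blinfun.sum_right[symmetric] euclidean_representation)
  have lin: "bounded_linear (\<lambda>z. blinfun_scaleR_left z o\<^sub>L blinfun_inner_left b :: 'b \<Rightarrow>\<^sub>L 'c)" for b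
    by (rule bounded_linear_compose[OF
          bounded_bilinear.bounded_linear_left[OF bounded_bilinear_blinfun_compose]
          bounded_linear_blinfun_scaleR_left])
  show ?thesis
    by (subst eq, rule Ck_on_sum, rule Ck_on_bounded_linear[OF lin assms])
qed

text \<open>Caratheodory's form of differentiability: with an exact slope operator
  \<open>F y\<close>, the relative remainder is at most \<open>norm (F y - F x)\<close>. The
  increments of the inverse of omega come in this form.\<close>

lemma has_derivative_CaratheodoryI:
  fixes F :: "'a::real_normed_vector \<Rightarrow> 'a \<Rightarrow>\<^sub>L 'b::real_normed_vector"
  assumes F: "\<And>y. y \<in> S \<Longrightarrow> f y - f x = F y (y - x)"
    and lim: "(F \<longlongrightarrow> F x) (at x within S)"
  shows "(f has_derivative F x) (at x within S)"
  unfolding has_derivative_iff_norm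
proof
  show "bounded_linear (F x)" by (rule blinfun.bounded_linear_right)
  have "((\<lambda>y. norm (F y - F x)) \<longlongrightarrow> 0) (at x within S)"
    using lim LIM_zero_iff tendsto_norm_zero by blast
  moreover have "norm (f y - f x - F x (y - x)) / norm (y - x) \<le> norm (F y - F x)" if "y \<in> S" "y \<noteq> x" for y
  proof -
    have "norm (f y - f x - F x (y - x)) \<le> norm (F y - F x) * norm (y - x)"
      unfolding F[OF that(1)] blinfun.diff_left[symmetric] by (rule norm_blinfun)
    then show ?thesis using that by (simp add: divide_simps)
  qed
  ultimately show "((\<lambda>y. norm (f y - f x - F x (y - x)) / norm (y - x)) \<longlongrightarrow> 0) (at x within S)"
    by (elim Lim_null_comparison[rotated]) (auto simp: eventually_at_filter)
qed

text \<open>The product is a parameter because square matrices are not an instance of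
  \<open>real_normed_algebra_1\<close>: their type class product is componentwise.\<close>

locale unital_bilinear = bounded_bilinear p
  for p :: "'b::real_normed_vector \<Rightarrow> 'b \<Rightarrow> 'b" +
  fixes e :: 'b
  assumes assoc: "p (p x y) z = p x (p y z)"
    and left_unit: "p e x = x" and right_unit: "p x e = x"
begin

text \<open>Resolvent identity: \<open>p (p b' (b - a)) a'\<close> expands to \<open>a' - b'\<close>
  by the left inverse of \<open>b\<close> and the right inverse of \<open>a\<close>.\<close>

lemma inverse_diff:
  assumes "p a a' = e" "p b' b = e"
  shows "b' - a' = - p (p b' (b - a)) a'"
proof -
  have "p (p b' a) a' = b'" "p (p b' b) a' = a'"
    using assms by (simp_all add: assoc left_unit right_unit)
  then show ?thesis by (simp add: diff_left diff_right)
qed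

text \<open>The resolvent identity bounds \<open>norm (g y - a')\<close> by
  \<open>norm (g y)\<close> times a null quantity; the same bound yields the eventual boundedness of
  \<open>g\<close>.\<close>

lemma tendsto_inverse:
  assumes f: "(f \<longlongrightarrow> a) F" and a: "p a a' = e"
    and g: "\<forall>\<^sub>F y in F. p (g y) (f y) = e"
  shows "(g \<longlongrightarrow> a') F"
proof -
  obtain K where K: "K > 0" "\<And>x y. norm (p x y) \<le> norm x * norm y * K"
    using pos_bounded by blast
  have K2: "norm (p (p x y) z) \<le> norm x * norm y * norm z * K^2" for x y z
  proof -
    have "norm (p (p x y) z) \<le> norm (p x y) * norm z * K" by (rule K)
    also have "\<dots> \<le> (norm x * norm y * K) * norm z * K"
      using K by (intro mult_right_mono) auto
    finally show ?thesis by (simp add: power2_eq_square mult_ac)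
  qed
  let ?r = "\<lambda>y. norm (f y - a) * norm a' * K^2"
  have r: "(?r \<longlongrightarrow> 0) F"
    using tendsto_norm_zero[OF LIM_zero[OF f]] by (intro tendsto_mult_left_zero)
  have 1: "\<forall>\<^sub>F y in F. norm (g y - a') \<le> norm (g y) * ?r y"
    using g
  proof eventually_elim
    case (elim y)
    show ?case unfolding inverse_diff[OF a elim] norm_minus_cancel
      using K2[of "g y" "f y - a" a'] by (simp add: mult_ac)
  qed
  \<comment> \<open>Below 1/2 the error is absorbed into the left side, which leaves
    \<open>norm (g y) \<le> 2 * norm a'\<close>.\<close>
  have 2: "\<forall>\<^sub>F y in F. ?r y < 1/2"
    using r by (rule order_tendstoD) simp
  have "\<forall>\<^sub>F y in F. norm (g y - a') \<le> 2 * norm a' * ?r y"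
    using 1 2
  proof eventually_elim
    case (elim y)
    have "norm (g y) \<le> norm a' + norm (g y - a')" by (metis norm_triangle_sub)
    also have "\<dots> \<le> norm a' + norm (g y) * (1/2)"
      using elim by (smt (verit) mult_left_mono norm_ge_zero)
    finally have "norm (g y) \<le> 2 * norm a'" by simp
    then have "norm (g y) * ?r y \<le> 2 * norm a' * ?r y" by (intro mult_right_mono) auto
    then show ?case using elim by linarith
  qed
  then have "((\<lambda>y. g y - a') \<longlongrightarrow> 0) F"
    by (rule Lim_null_comparison[OF _ tendsto_mult_right_zero[OF r]])
  then show ?thesis by (rule LIM_zero_cancel)
qed

text \<open>The resolvent identity gives the increment of \<open>g\<close> exactly. Replacing the
  increment of \<open>f\<close> by its linear part, and then \<open>g y\<close> by
  \<open>g x\<close>, leaves two error terms that are estimated separately.\<close>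

lemma has_derivative_inverse:
  assumes f: "(f has_derivative f') (at x within S)" and x: "p (f x) (g x) = e"
    and g: "\<And>y. y \<in> S \<Longrightarrow> p (g y) (f y) = e"
  shows "(g has_derivative (\<lambda>v. - p (p (g x) (f' v)) (g x))) (at x within S)"
proof -
  let ?F = "at x within S"
  have lin: "bounded_linear f'" using f by (rule has_derivative_bounded_linear)
  let ?q = "\<lambda>y. (y - x) /\<^sub>R norm (y - x)"
  let ?r = "\<lambda>y. (1 / norm (y - x)) *\<^sub>R (f y - (f x + f' (y - x)))"
  have r: "(?r \<longlongrightarrow> 0) ?F"
    using f by (simp add: has_derivative_within)
  have gx: "(g \<longlongrightarrow> g x) ?F"
  proof (rule tendsto_inverse[OF _ x])
    show "(f \<longlongrightarrow> f x) ?F" using has_derivative_continuous[OF f] by (simp add: continuous_within)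
    show "\<forall>\<^sub>F y in ?F. p (g y) (f y) = e" using g by (auto simp: eventually_at_filter)
  qed
  \<comment> \<open>Divided by the distance, the argument of \<open>f'\<close> has norm at most 1,
    so these values stay bounded and the null factor \<open>g y - g x\<close> wins.\<close>
  have "Bfun (\<lambda>y. f' (?q y)) ?F"
  proof -
    obtain C where "\<And>v. norm (f' v) \<le> norm v * C" "C \<ge> 0"
      using bounded_linear.nonneg_bounded[OF lin] by blast
    moreover have "norm (?q y) \<le> 1" for y by (simp add: divide_simps)
    ultimately have "norm (f' (?q y)) \<le> C" for y
      by (smt (verit) mult_left_le_one_le norm_ge_zero)
    then show ?thesis by (intro BfunI[of _ C]) simp
  qed
  moreover have "Zfun (\<lambda>y. g y - g x) ?F" using gx tendsto_Zfun_iff by blast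
  ultimately have "Zfun (\<lambda>y. p (g y - g x) (f' (?q y))) ?F" by (rule Zfun_prod_Bfun[rotated])
  then have z: "((\<lambda>y. p (g y - g x) (f' (?q y))) \<longlongrightarrow> 0) ?F" by (simp add: tendsto_Zfun_iff)
  have "((\<lambda>y. - p (p (g y) (?r y)) (g x) - p (p (g y - g x) (f' (?q y))) (g x)) 
      \<longlongrightarrow> - p (p (g x) 0) (g x) - p 0 (g x)) ?F"
    by (intro tendsto_intros tendsto gx r z)
  then have lim: "((\<lambda>y. - p (p (g y) (?r y)) (g x) - p (p (g y - g x) (f' (?q y))) (g x)) \<longlongrightarrow> 0) ?F"
    by (simp add: zero_left zero_right)
  have eq: "(1 / norm (y - x)) *\<^sub>R (g y - (g x + - p (p (g x) (f' (y - x))) (g x)))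
      = - p (p (g y) (?r y)) (g x) - p (p (g y - g x) (f' (?q y))) (g x)" if "y \<in> S" for y
  proof -
    have "g y - g x = - p (p (g y) (f y - f x)) (g x)"
      using inverse_diff[OF x g[OF that]] .
    then have "g y - (g x + - p (p (g x) (f' (y - x))) (g x)) =
      - p (p (g y) (f y - (f x + f' (y - x)))) (g x) - p (p (g y - g x) (f' (y - x))) (g x)"
      by (simp add: diff_left diff_right add_left add_right algebra_simps)
    then show ?thesis
      by (simp only: linear_cmul[OF bounded_linear.linear[OF lin]] scaleR_left scaleR_right)
        (simp add: scaleR_diff_right divide_inverse)
  qed
  have "((\<lambda>y. (1 / norm (y - x)) *\<^sub>R (g y - (g x + - p (p (g x) (f' (y - x))) (g x)))) \<longlongrightarrow> 0) ?F"
    by (rule Lim_transform_eventually[OF lim], unfold eventually_at_filter,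
        intro always_eventually allI impI, rule eq[symmetric])
  moreover have "bounded_linear (\<lambda>v. - p (p (g x) (f' v)) (g x))"
    by (intro bounded_linear_minus bounded_linear_compose[OF bounded_linear_left]
       bounded_linear_compose[OF bounded_linear_right] lin)
  ultimately show ?thesis by (simp add: has_derivative_within)
qed

text \<open>The derivative of \<open>g\<close> is built from \<open>g\<close> itself and the
  derivative of \<open>f\<close>, so each order of smoothness of \<open>g\<close> yields the
  next.\<close>

lemma Ck_on_inverse:
  assumes "Ck_on n V S f" and "\<And>y. y \<in> S \<Longrightarrow> p (f y) (g y) = e" and "\<And>y. y \<in> S \<Longrightarrow> p (g y) (f y) = e"
  shows "Ck_on n V S g"
  using assms(1)
proof (induction n)
  case 0
  show ?case unfolding Ck_on.simps continuous_on_def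
  proof
    fix x assume x: "x \<in> S"
    show "(g \<longlongrightarrow> g x) (at x within S)"
      using 0 x assms(3)
      by (intro tendsto_inverse[where f = f, OF _ assms(2)[OF x]]) (auto simp: continuous_on_def eventually_at_filter)
  qed
next
  case (Suc n)
  then obtain f' where f': "\<And>x. x \<in> S \<Longrightarrow> (f has_derivative f' x) (at x within S)"
    "\<And>v. v \<in> V \<Longrightarrow> Ck_on n V S (\<lambda>x. f' x v)" by auto
  have g: "Ck_on n V S g" using Suc Ck_on_SucD by blast
  have "Ck_on n V S (\<lambda>x. - p (p (g x) (f' x v)) (g x))" if "v \<in> V" for v
    by (intro Ck_on_bounded_linear[OF bounded_linear_minus[OF bounded_linear_ident]]
        Ck_on_bounded_bilinear[OF bounded_bilinear_axioms] g f' that)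
  moreover have "(g has_derivative (\<lambda>v. - p (p (g x) (f' x v)) (g x))) (at x within S)" if "x \<in> S" for x
    using has_derivative_inverse f'(1) assms(2,3) that by blast
  ultimately show ?case unfolding Ck_on.simps
    by (intro exI[where x = "\<lambda>x v. - p (p (g x) (f' x v)) (g x)"] conjI ballI)
qed

end

section \<open>Positive definite complex matrices\<close>

text \<open>Ties the real Euclidean structure to the Hermitian form, so that Euclidean facts apply
  to complex vectors and matrices.\<close>

lemma inner_eq_Re_cnj: "x \<bullet> y = Re (\<Sum>i\<in>UNIV. cnj (x $ i) * y $ i)" for x y :: "complex^'n"
  by (simp add: inner_vec_def inner_complex_def)

lemma herm_posdef_iff:
  "herm_posdef A \<longleftrightarrow> ctranspose A = A \<and> (\<forall>x. x \<noteq> 0 \<longrightarrow> 0 < x \<bullet> (A *v x))"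
  by (simp only: herm_posdef_def inner_eq_Re_cnj)

definition herm_psd :: "complex^'m^'m \<Rightarrow> bool" where
  "herm_psd A \<longleftrightarrow> ctranspose A = A \<and> (\<forall>x. 0 \<le> x \<bullet> (A *v x))"

lemma herm_posdef_imp_psd: "herm_posdef A \<Longrightarrow> herm_psd A"
  unfolding herm_posdef_iff herm_psd_def by (metis inner_zero_left less_imp_le order_refl)

lemma inner_matrix_left_adj: "(A *v x) \<bullet> y = x \<bullet> (ctranspose A *v y)" for x :: "complex^'n"
proof -
  have "(A *v x) \<bullet> y = Re (\<Sum>i\<in>UNIV. \<Sum>j\<in>UNIV. cnj (A $ i $ j) * cnj (x $ j) * y $ i)"
    by (simp add: inner_eq_Re_cnj matrix_vector_mult_def sum_distrib_right)
  also have "\<dots> = x \<bullet> (ctranspose A *v y)"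
    by (subst sum.swap) (simp add: inner_eq_Re_cnj ctranspose_def matrix_vector_mult_def sum_distrib_left mult_ac)
  finally show ?thesis .
qed

lemma inner_herm: "ctranspose A = A \<Longrightarrow> (A *v x) \<bullet> y = x \<bullet> (A *v y)" for x :: "complex^'n"
  by (simp add: inner_matrix_left_adj)

lemma ctranspose_add: "ctranspose (A + B) = ctranspose A + ctranspose B"
  by (simp add: ctranspose_def vec_eq_iff)
lemma ctranspose_diff: "ctranspose (A - B) = ctranspose A - ctranspose B"
  by (simp add: ctranspose_def vec_eq_iff)
lemma ctranspose_zero: "ctranspose 0 = 0"
  by (simp add: ctranspose_def vec_eq_iff)
lemma ctranspose_scaleR: "ctranspose (r *\<^sub>R A) = r *\<^sub>R ctranspose A"
  by (simp add: ctranspose_def vec_eq_iff)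
lemma ctranspose_mult: "ctranspose (A ** B) = ctranspose B ** ctranspose A"
  by (simp add: ctranspose_def matrix_matrix_mult_def vec_eq_iff mult.commute)
lemma ctranspose_mat1: "ctranspose (mat 1) = mat 1"
  by (simp add: ctranspose_def mat_def vec_eq_iff)
lemma ctranspose_sum: "ctranspose (\<Sum>i\<in>I. f i) = (\<Sum>i\<in>I. ctranspose (f i))"
  by (induction I rule: infinite_finite_induct) (simp_all add: ctranspose_add ctranspose_zero)
lemma ctranspose_mscale: "ctranspose (mscale c A) = mscale (cnj c) (ctranspose A)"
  by (simp add: ctranspose_def mscale_def vec_eq_iff)

lemma herm_entry: "ctranspose A = A \<Longrightarrow> cnj (A $ i $ j) = A $ j $ i"
  by (metis (no_types, lifting) ctranspose_def vec_lambda_beta)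

lemma bounded_bilinear_matrix_vector_mult:
  "bounded_bilinear ((*v) :: complex^'n^'m \<Rightarrow> complex^'n \<Rightarrow> complex^'m)"
  unfolding bilinear_conv_bounded_bilinear[symmetric] bilinear_def
  by (auto intro!: linearI simp: matrix_vector_mult_add_rdistrib matrix_vector_right_distrib)
    (simp_all add: matrix_vector_mult_def vec_eq_iff scaleR_sum_right)

lemma unital_bilinear_matrix_mult:
  "unital_bilinear ((**) :: complex^'m^'m \<Rightarrow> complex^'m^'m \<Rightarrow> complex^'m^'m) (mat 1)"
proof (rule unital_bilinear.intro)
  show "bounded_bilinear ((**) :: complex^'m^'m \<Rightarrow> complex^'m^'m \<Rightarrow> complex^'m^'m)"
    unfolding bilinear_conv_bounded_bilinear[symmetric] bilinear_def
    by (auto intro!: linearI)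
      (simp_all add: matrix_matrix_mult_def vec_eq_iff scaleR_sum_right sum.distrib distrib_left distrib_right)
qed (unfold_locales, simp_all add: matrix_mul_assoc)

interpretation matrix: unital_bilinear
  "(**) :: complex^'m^'m \<Rightarrow> complex^'m^'m \<Rightarrow> complex^'m^'m" "mat 1"
  by (rule unital_bilinear_matrix_mult)

interpretation mvec: bounded_bilinear "(*v) :: complex^'n^'m \<Rightarrow> complex^'n \<Rightarrow> complex^'m"
  by (rule bounded_bilinear_matrix_vector_mult)

section \<open>Rank one matrices and Cholesky decomposition\<close>

text \<open>The rank one matrix w w*. Sums of these take the place of a spectral
  decomposition.\<close>

definition outer :: "complex^'m \<Rightarrow> complex^'m^'m" where
  "outer w = (\<chi> i j. w $ i * cnj (w $ j))"

lemma ctranspose_outer: "ctranspose (outer w) = outer w"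
  by (simp add: ctranspose_def outer_def vec_eq_iff)

text \<open>The inner product of matrices is Re tr(X* Y); cyclicity of the trace turns the factor w
  w* into evaluation at w.\<close>

lemma inner_mult_outer: "X \<bullet> (Y ** outer w) = (X *v w) \<bullet> (Y *v w)"
proof -
  have "(\<Sum>j\<in>UNIV. X $ i $ j \<bullet> (Y ** outer w) $ i $ j) = (X *v w) $ i \<bullet> (Y *v w) $ i" for i
  proof -
    have "(\<Sum>j\<in>UNIV. X $ i $ j \<bullet> (Y ** outer w) $ i $ j)
      = Re (\<Sum>j\<in>UNIV. cnj (X $ i $ j) * ((Y *v w) $ i * cnj (w $ j)))"
      by (simp add: inner_complex_def outer_def matrix_matrix_mult_def matrix_vector_mult_def
          sum_distrib_right mult.assoc)
    also have "\<dots> = (X *v w) $ i \<bullet> (Y *v w) $ i"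
    proof -
      have "cnj ((X *v w) $ i) * (Y *v w) $ i = (\<Sum>j\<in>UNIV. cnj (X $ i $ j) * ((Y *v w) $ i * cnj (w $ j)))"
        by (simp add: matrix_vector_mult_def[of X] sum_distrib_left sum_distrib_right mult_ac)
      from this[symmetric] show ?thesis by (simp add: inner_complex_def)
    qed
    finally show ?thesis .
  qed
  then show ?thesis by (simp add: inner_vec_def)
qed

lemma inner_outer: "X \<bullet> outer w = (X *v w) \<bullet> w"
  using inner_mult_outer[of X "mat 1" w] by simp

text \<open>At e - s P e, with e the i-th unit vector, the form equals -2 s |P e|^2 + s^2 c with c
  >= 0. A nonzero column would make this negative for small s > 0.\<close>

lemma psd_diag_zero:
  assumes P: "herm_psd P" and d: "Re (P $ i $ i) = 0"
  shows "P $ k $ i = 0"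
proof -
  let ?e = "axis i 1 :: complex^'a"
  let ?v = "P *v ?e"
  let ?c = "?v \<bullet> (P *v ?v)"
  have v: "?v $ k = P $ k $ i" for k
    by (simp add: matrix_vector_mult_def axis_def if_distrib cong: if_cong)
  have e: "?e \<bullet> ?v = 0" using d by (simp add: inner_axis' v inner_complex_def)
  have c: "?c \<ge> 0" using P by (simp add: herm_psd_def)
  have ineq: "0 \<le> - 2 * s * (?v \<bullet> ?v) + s^2 * ?c" for s
  proof -
    have "0 \<le> (?e - s *\<^sub>R ?v) \<bullet> (P *v (?e - s *\<^sub>R ?v))" using P by (simp add: herm_psd_def)
    also have "\<dots> = - 2 * s * (?v \<bullet> ?v) + s^2 * ?c"
      using P e inner_herm[of P ?e ?v]
      by (simp add: herm_psd_def mvec.diff_right mvec.scaleR_right inner_diff_left inner_diff_right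
          power2_eq_square right_diff_distrib)
    finally show ?thesis .
  qed
  have "?v \<bullet> ?v = 0"
  proof (rule ccontr)
    assume "?v \<bullet> ?v \<noteq> 0"
    then have vv: "?v \<bullet> ?v > 0" by simp
    \<comment> \<open>Adding 1 keeps the denominator positive and gives s c <= |P e|^2, against 2 |P
      e|^2 <= s c.\<close>
    let ?s = "(?v \<bullet> ?v) / (?c + 1)"
    have s: "?s > 0" using vv c by simp
    have "?s * (2 * (?v \<bullet> ?v)) \<le> ?s * (?s * ?c)"
      using ineq[of ?s] unfolding power2_eq_square by linarith
    then have "2 * (?v \<bullet> ?v) \<le> ?s * ?c" using s mult_le_cancel_left_pos by blast
    also have "\<dots> \<le> ?v \<bullet> ?v" using vv c by (simp add: divide_simps)
    finally show False using vv by simp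
  qed
  then show ?thesis using v by (simp add: vec_eq_iff)
qed

text \<open>Cholesky's algorithm: each step subtracts a rank one matrix that clears one more column
  and leaves a positive semidefinite matrix.\<close>

lemma psd_sum_outer_aux:
  assumes "finite K" and "herm_psd P" and "\<And>k j. j \<notin> K \<Longrightarrow> P $ k $ j = 0"
  shows "\<exists>ws. P = sum_list (map outer ws)"
  using assms
proof (induction K arbitrary: P)
  case empty
  then have "P = sum_list (map outer [])" by (simp add: vec_eq_iff)
  then show ?case by blast
next
  case (insert i K)
  have herm: "ctranspose P = P" and psd: "\<And>x. 0 \<le> x \<bullet> (P *v x)"
    using insert.prems(1) by (auto simp: herm_psd_def)
  define d where "d = Re (P $ i $ i)"
  have Pii: "P $ i $ i = of_real d"
    using herm_entry[OF herm, of i i] by (simp add: d_def complex_eq_iff)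
  show ?case
  \<comment> \<open>A zero pivot forces its whole column to vanish, so \<open>i\<close> is dropped
    without subtracting anything.\<close>
  proof (cases "d = 0")
    case True
    have "P $ k $ j = 0" if "j \<notin> K" for k j
      using psd_diag_zero[OF insert.prems(1), of i k] insert.prems(2)[of j k] True that
      by (cases "j = i") (auto simp: d_def)
    then show ?thesis using insert.IH insert.prems(1) by blast
  next
    case False
    have Pax: "(P *v axis i t) $ k = P $ k $ i * t" for t k
      by (simp add: matrix_vector_mult_def axis_def if_distrib cong: if_cong)
    have "d \<ge> 0"
      using psd[of "axis i 1"] by (simp add: inner_axis' Pax d_def inner_complex_def)
    then have d: "d > 0" using False by simp
    \<comment> \<open>The pivot column over the square root of the pivot: \<open>outer w\<close>
      agrees with \<open>P\<close> in column \<open>i\<close> and vanishes in the columns already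
      cleared.\<close>
    define w where "w = (\<chi> k. P $ k $ i / of_real (sqrt d))"
    define P' where "P' = P - outer w"
    have sq: "complex_of_real (sqrt d) * of_real (sqrt d) = of_real d"
      using d by (simp flip: of_real_mult)
    have ow: "outer w $ k $ j = P $ k $ i * P $ i $ j / of_real d" for k j
      by (simp add: outer_def w_def herm_entry[OF herm] sq)
    have cols: "P' $ k $ j = 0" if "j \<notin> K" for k j
      using insert.prems(2)[of j] that d
      by (cases "j = i") (auto simp: P'_def ow Pii)
    have "0 \<le> x \<bullet> (P' *v x)" for x
    proof -
      \<comment> \<open>Completing the square: this \<open>t\<close> makes entry \<open>i\<close> of
        \<open>P *v (x - z)\<close> vanish, and the form of \<open>P'\<close> at \<open>x\<close>
        becomes that of \<open>P\<close> at \<open>x - z\<close>.\<close>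
      define t where "t = (P *v x) $ i / of_real d"
      define z where "z = axis i t"
      have td: "t * of_real d = (P *v x) $ i" using d by (simp add: t_def)
      have owx: "outer w *v x = P *v z"
        by (simp add: vec_eq_iff z_def Pax t_def) 
          (simp add: matrix_vector_mult_def ow sum_distrib_left sum_divide_distrib mult_ac)
      have zz: "z \<bullet> (P *v z) = z \<bullet> (P *v x)"
        by (simp add: z_def inner_axis' Pax Pii td[symmetric] mult_ac)
      have xz: "x \<bullet> (P *v z) = z \<bullet> (P *v x)"
        using inner_herm[OF herm, of x z] by (simp add: inner_commute)
      have "x \<bullet> (P' *v x) = x \<bullet> (P *v x) - x \<bullet> (P *v z)"
        by (simp add: P'_def mvec.diff_left owx inner_diff_right)
      also have "\<dots> = (x - z) \<bullet> (P *v (x - z))"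
        by (simp add: mvec.diff_right inner_diff_left inner_diff_right zz xz)
      finally show ?thesis using psd by simp
    qed
    then have "herm_psd P'"
      by (simp add: herm_psd_def P'_def ctranspose_diff ctranspose_outer herm)
    then obtain ws where "P' = sum_list (map outer ws)" using insert.IH cols by blast
    then have "P = sum_list (map outer (w # ws))" by (simp add: P'_def algebra_simps)
    then show ?thesis by blast
  qed
qed

lemma psd_sum_outer: "herm_psd P \<Longrightarrow> \<exists>ws. P = sum_list (map outer ws)"
  using psd_sum_outer_aux[of UNIV P] by simp

section \<open>Inverses and quantitative positivity\<close>

lemma herm_posdef_inverse:
  assumes "herm_posdef A"
  shows "A ** matrix_inv A = mat 1" and "matrix_inv A ** A = mat 1"
proof -
  have "invertible A"
    unfolding invertible_left_inverse matrix_left_invertible_ker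
    using assms by (metis herm_posdef_iff inner_zero_right less_irrefl)
  then have "\<exists>B. A ** B = mat 1 \<and> B ** A = mat 1" by (simp add: invertible_def)
  then have "A ** matrix_inv A = mat 1 \<and> matrix_inv A ** A = mat 1"
    unfolding matrix_inv_def by (rule someI_ex)
  then show "A ** matrix_inv A = mat 1" and "matrix_inv A ** A = mat 1" by auto
qed

text \<open>Substituting x = A y turns the form of the inverse at x into the form of A at y.\<close>

lemma herm_posdef_matrix_inv:
  assumes "herm_posdef A"
  shows "herm_posdef (matrix_inv A)"
proof -
  let ?B = "matrix_inv A"
  note inv = herm_posdef_inverse[OF assms]
  have hA: "ctranspose A = A" using assms by (simp add: herm_posdef_iff)
  have "ctranspose ?B ** A = mat 1"
    using arg_cong[OF inv(1), of ctranspose] by (simp add: ctranspose_mult ctranspose_mat1 hA)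
  then have "ctranspose ?B = ?B"
    by (metis inv(1) matrix_mul_assoc matrix_mul_lid matrix_mul_rid)
  moreover have "0 < x \<bullet> (?B *v x)" if "x \<noteq> 0" for x
  proof -
    have x: "A *v (?B *v x) = x" by (simp add: matrix_vector_mul_assoc inv)
    then have "?B *v x \<noteq> 0" using that by auto
    then have "0 < (?B *v x) \<bullet> (A *v (?B *v x))" using assms by (simp add: herm_posdef_iff)
    then show ?thesis by (simp add: x inner_commute)
  qed
  ultimately show ?thesis by (simp add: herm_posdef_iff)
qed

text \<open>The constant is the minimum of the form on the compact unit sphere; scaling extends the
  bound to all vectors.\<close>

lemma herm_posdef_lower_bound:
  assumes "herm_posdef A"
  shows "\<exists>c>0. \<forall>x. c * (norm x)^2 \<le> x \<bullet> (A *v x)"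
proof -
  have "continuous_on (sphere 0 1) (\<lambda>x. x \<bullet> (A *v x))"
    by (intro continuous_intros mvec.continuous_on)
  moreover have "(axis undefined 1 :: complex^'a) \<in> sphere 0 1" by simp
  ultimately obtain x0 :: "complex^'a" where x0: "x0 \<in> sphere 0 1"
    "\<And>x. x \<in> sphere 0 1 \<Longrightarrow> x0 \<bullet> (A *v x0) \<le> x \<bullet> (A *v x)"
    using continuous_attains_inf[of "sphere 0 1 :: (complex^'a) set" "\<lambda>x. x \<bullet> (A *v x)"] by auto
  let ?c = "x0 \<bullet> (A *v x0)"
  have "x0 \<noteq> 0" using x0(1) by auto
  then have "?c > 0" using assms by (simp add: herm_posdef_iff)
  moreover have "?c * (norm x)^2 \<le> x \<bullet> (A *v x)" for x
  proof (cases "x = 0")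
    case False
    have "?c \<le> (x /\<^sub>R norm x) \<bullet> (A *v (x /\<^sub>R norm x))"
      using False by (intro x0(2)) simp
    also have "\<dots> = (x \<bullet> (A *v x)) / (norm x)^2"
      by (simp add: mvec.scaleR_right power2_eq_square divide_inverse)
    finally show ?thesis using False by (simp add: field_simps)
  qed simp
  ultimately show ?thesis by blast
qed

text \<open>A perturbation below \<open>c / K\<close> changes the form by less than
  \<open>c * (norm x)^2\<close>. Symmetry of \<open>B\<close> is required separately because
  closeness does not imply it.\<close>

lemma herm_posdef_near:
  assumes "herm_posdef A"
  shows "\<exists>e>0. \<forall>B. ctranspose B = B \<longrightarrow> dist B A < e \<longrightarrow> herm_posdef B"
proof -
  obtain c where c: "c > 0" "\<And>x. c * (norm x)^2 \<le> x \<bullet> (A *v x)"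
    using herm_posdef_lower_bound[OF assms] by blast
  obtain K where K: "K > 0" "\<And>(B :: complex^'a^'a) x. norm (B *v x) \<le> norm B * norm x * K"
    using mvec.pos_bounded by blast
  have "herm_posdef B" if "ctranspose B = B" "dist B A < c / K" for B
    unfolding herm_posdef_iff
  proof (intro conjI allI impI that(1))
    fix x :: "complex^'a" assume x: "x \<noteq> 0"
    have "\<bar>x \<bullet> ((B - A) *v x)\<bar> \<le> norm x * norm ((B - A) *v x)" by (rule Cauchy_Schwarz_ineq2)
    also have "\<dots> \<le> norm x * (norm (B - A) * norm x * K)" by (intro mult_left_mono K) simp
    also have "\<dots> = (norm (B - A) * K) * (norm x)^2" by (simp add: power2_eq_square)
    also have "\<dots> < c * (norm x)^2"
      using that(2) K(1) x by (intro mult_strict_right_mono) (auto simp: dist_norm field_simps)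
    finally have "\<bar>x \<bullet> ((B - A) *v x)\<bar> < x \<bullet> (A *v x)" using c(2)[of x] by linarith
    then show "0 < x \<bullet> (B *v x)" by (simp add: mvec.diff_left inner_diff_right)
  qed
  then show ?thesis using c(1) K(1) by (intro exI[of _ "c / K"]) auto
qed

text \<open>On w w* the inner product is w* P w >= c |w|^2, which dominates c times the norm. Every
  positive semidefinite matrix is a sum of such terms, and the triangle inequality adds up the
  bounds.\<close>

lemma herm_posdef_inner_lower_bound:
  assumes "herm_posdef P"
  shows "\<exists>c>0. \<forall>X. herm_psd X \<longrightarrow> c * norm X \<le> P \<bullet> X"
proof -
  obtain c where c: "c > 0" "\<And>x. c * (norm x)^2 \<le> x \<bullet> (P *v x)"
    using herm_posdef_lower_bound[OF assms] by blast
  have "norm (outer w) \<le> (norm w)^2" for w :: "complex^'a"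
  proof -
    have "(\<Sum>j\<in>UNIV. cnj (w $ j) * w $ j) = of_real (w \<bullet> w)"
      by (simp add: inner_vec_def inner_complex_def complex_eq_iff)
    then have "outer w *v w = (w \<bullet> w) *\<^sub>R w"
      by (simp add: outer_def matrix_vector_mult_def vec_eq_iff mult.assoc flip: sum_distrib_left)
        (simp add: scaleR_conv_of_real)
    then have "outer w \<bullet> outer w = (norm w)^2 * (norm w)^2"
      by (simp add: inner_outer power2_norm_eq_inner)
    then show ?thesis
      by (metis norm_eq_sqrt_inner real_sqrt_mult_self abs_power2 eq_refl real_sqrt_abs2)
  qed
  note outer_le = this
  have "c * norm (sum_list (map outer ws)) \<le> P \<bullet> sum_list (map outer ws)" for ws
  proof (induction ws)
    case (Cons w ws)
    have "c * norm (outer w + sum_list (map outer ws)) \<le> c * (norm w)^2 + c * norm (sum_list (map outer ws))"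
      using c(1) norm_triangle_ineq[of "outer w" "sum_list (map outer ws)"] outer_le[of w]
      by (simp flip: distrib_left)
    also have "\<dots> \<le> P \<bullet> outer w + P \<bullet> sum_list (map outer ws)"
      using c(2)[of w] Cons.IH by (simp add: inner_outer inner_commute)
    finally show ?case by (simp add: inner_add_right)
  qed simp
  then show ?thesis using c(1) psd_sum_outer by metis
qed

text \<open>Writing R as a sum of matrices w w* turns the left side into the sum of the forms of P
  at the vectors D w. If it vanishes then D R = 0, hence D = 0 because R is invertible.\<close>

lemma inner_sandwich_pos:
  fixes P D R :: "complex^'m^'m"
  assumes P: "herm_posdef P" and R: "herm_posdef R" and D: "D \<noteq> 0"
  shows "0 < D \<bullet> (P ** D ** R)"
proof -
  obtain ws where ws: "R = sum_list (map outer ws)"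
    using psd_sum_outer[OF herm_posdef_imp_psd[OF R]] by blast
  \<comment> \<open>The induction carries the equality case along, which is what gives strictness at
    the end.\<close>
  have ge: "0 \<le> D \<bullet> (P ** D ** sum_list (map outer us)) \<and>
      (D \<bullet> (P ** D ** sum_list (map outer us)) = 0 \<longrightarrow> D ** sum_list (map outer us) = 0)" for us
  proof (induction us)
    case (Cons u us)
    let ?a = "(D *v u) \<bullet> (P *v (D *v u))"
    have eq: "D \<bullet> (P ** D ** sum_list (map outer (u # us))) = ?a + D \<bullet> (P ** D ** sum_list (map outer us))"
      by (simp add: matrix_add_ldistrib inner_add_right inner_mult_outer matrix_vector_mul_assoc)
    have a: "0 \<le> ?a" using herm_posdef_imp_psd[OF P] by (simp add: herm_psd_def)
    have "D ** outer u = 0" if "?a = 0"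
    proof -
      have "D *v u = 0" using that P by (metis herm_posdef_iff less_irrefl)
      moreover have "(D ** outer u) $ i $ j = (D *v u) $ i * cnj (u $ j)" for i j
        by (simp add: matrix_matrix_mult_def matrix_vector_mult_def outer_def sum_distrib_right mult.assoc)
      ultimately show ?thesis by (simp add: vec_eq_iff)
    qed
    then show ?case using Cons.IH a unfolding eq
      by (auto simp: matrix_add_ldistrib add_nonneg_eq_0_iff)
  qed simp
  have "D ** R \<noteq> 0"
  proof
    assume "D ** R = 0"
    then have "D ** (R ** matrix_inv R) = 0" by (simp only: matrix_mul_assoc matrix.zero_left)
    then show False using D by (simp add: herm_posdef_inverse[OF R])
  qed
  then show ?thesis using ge[of ws] ws by force
qed

text \<open>For A a sum of matrices w w*, the form at x is the sum of |w* x|^2; if it vanishes, so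
  does A x. This recognises limits of positive definite matrices that are still positive
  definite.\<close>

lemma psd_injective_imp_posdef:
  assumes A: "herm_psd A" and inj: "\<And>x. A *v x = 0 \<Longrightarrow> x = 0"
  shows "herm_posdef A"
proof -
  obtain ws where ws: "A = sum_list (map outer ws)" using psd_sum_outer[OF A] by blast
  have ge: "0 \<le> x \<bullet> (sum_list (map outer us) *v x) \<and>
     (x \<bullet> (sum_list (map outer us) *v x) = 0 \<longrightarrow> sum_list (map outer us) *v x = 0)" for us x
  proof (induction us)
    case (Cons u us)
    let ?z = "\<Sum>j\<in>UNIV. cnj (u $ j) * x $ j"
    have ox: "(outer u *v x) $ i = u $ i * ?z" for i
      by (simp add: outer_def matrix_vector_mult_def mult.assoc sum_distrib_left)
    have "x \<bullet> (outer u *v x) = Re ((\<Sum>i\<in>UNIV. cnj (x $ i) * u $ i) * ?z)"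
      by (simp only: inner_eq_Re_cnj ox sum_distrib_right mult.assoc)
    also have "(\<Sum>i\<in>UNIV. cnj (x $ i) * u $ i) = cnj ?z" by (simp add: mult.commute)
    also have "Re (cnj ?z * ?z) = (cmod ?z)^2"
      by (metis Re_complex_of_real complex_norm_square mult.commute)
    finally have xox: "x \<bullet> (outer u *v x) = (cmod ?z)^2" .
    have "outer u *v x = 0" if "x \<bullet> (outer u *v x) = 0"
      using that by (simp only: xox) (simp add: vec_eq_iff ox)
    moreover have "0 \<le> x \<bullet> (outer u *v x)" by (simp only: xox) simp
    ultimately show ?case using Cons.IH
      by (auto simp: mvec.add_left inner_add_right add_nonneg_eq_0_iff)
  qed simp
  show ?thesis unfolding herm_posdef_iff
  proof (intro conjI allI impI)
    show "ctranspose A = A" using A by (simp add: herm_psd_def)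
    show "0 < x \<bullet> (A *v x)" if "x \<noteq> 0" for x
      using ge[of x ws] inj[of x] that ws by force
  qed
qed

section \<open>Orthogonality of characters on the grid\<close>

text \<open>Presents the grid as a product of intervals, so that sums over it factor by
  coordinate.\<close>

lemma grid_index_eq: "grid_index N = vec_lambda ` (PiE UNIV (\<lambda>j. {0..<int (N $ j)}))"
proof -
  have "l \<in> vec_lambda ` (PiE UNIV (\<lambda>j. {0..<int (N $ j)}))" if "l \<in> grid_index N" for l
    using that by (intro image_eqI[of _ _ "($) l"]) (auto simp: grid_index_def PiE_def vec_lambda_eta)
  then show ?thesis by (auto simp: grid_index_def PiE_def)
qed

lemma finite_grid_index: "finite (grid_index N)"
  unfolding grid_index_eq by (intro finite_imageI finite_PiE) auto

text \<open>A geometric sum of the powers of w = exp(2 pi i k / n), where w^n = 1, and w = 1 exactly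
  when n divides k.\<close>

lemma sum_roots_of_unity:
  assumes "n > 0"
  shows "(\<Sum>t\<in>{0..<int n}. exp (\<i> * of_real (of_int k * (2 * pi * of_int t / of_nat n))))
    = (if int n dvd k then of_nat n else 0)"
proof -
  define w where "w = exp (\<i> * of_real (of_int k * (2 * pi / of_nat n)))"
  have term_eq: "exp (\<i> * of_real (of_int k * (2 * pi * of_int (int s) / of_nat n))) = w ^ s" for s
    unfolding w_def exp_of_nat_mult[symmetric] by (simp add: mult_ac)
  have "{0..<int n} = int ` {..<n}"
    using image_int_atLeastLessThan[of 0 n] by (simp add: atLeast0LessThan)
  then have "(\<Sum>t\<in>{0..<int n}. exp (\<i> * of_real (of_int k * (2 * pi * of_int t / of_nat n)))) = (\<Sum>s<n. w ^ s)"
    by (simp only: sum.reindex[OF inj_on_of_nat] comp_def term_eq)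
  also have "\<dots> = (if int n dvd k then of_nat n else 0)"
  proof -
    have w1: "w = 1 \<longleftrightarrow> int n dvd k"
    proof -
      have "w = 1 \<longleftrightarrow> (\<exists>m::int. of_int k * (2 * pi / of_nat n) = of_int (2 * m) * pi)"
        by (simp add: w_def exp_eq_1)
      also have "\<dots> \<longleftrightarrow> (\<exists>m::int. k = int n * m)"
      proof (intro ex_cong1)
        fix m
        have "of_int k * (2 * pi / of_nat n) = of_int (2 * m) * pi \<longleftrightarrow> real_of_int k = real_of_int (int n * m)"
          using assms by (simp add: field_simps)
        then show "of_int k * (2 * pi / of_nat n) = of_int (2 * m) * pi \<longleftrightarrow> k = int n * m"
          by (simp only: of_int_eq_iff)
      qed
      finally show ?thesis by (simp add: dvd_def)
    qed
    have "w ^ n = exp (of_int k * (2 * of_real pi * \<i>))"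
      unfolding w_def exp_of_nat_mult[symmetric] using assms by (simp add: mult_ac)
    also have "\<dots> = 1"
      unfolding exp_eq_1 by (auto intro!: exI[of _ k])
    finally show ?thesis using w1 by (cases "w = 1") (auto simp: geometric_sum)
  qed
  finally show ?thesis .
qed

lemma sum_characters_grid:
  fixes N :: "nat^'d"
  assumes "\<And>j. N $ j > 0"
  shows "(\<Sum>l\<in>grid_index N. exp (\<i> * of_real (freq_pairing k (grid_point N l))))
    = (if \<forall>j. int (N $ j) dvd k $ j then of_nat (\<Prod>j\<in>UNIV. N $ j) else 0)"
proof -
  let ?f = "\<lambda>j t. exp (\<i> * of_real (of_int (k $ j) * (2 * pi * of_int t / of_nat (N $ j)))) :: complex"
  have inj: "inj_on vec_lambda (PiE UNIV (\<lambda>j. {0..<int (N $ j)}))"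
    by (metis inj_on_inverseI vec_lambda_inverse UNIV_I)
  have "(\<Sum>l\<in>grid_index N. exp (\<i> * of_real (freq_pairing k (grid_point N l))))
    = (\<Sum>g\<in>PiE UNIV (\<lambda>j. {0..<int (N $ j)}). \<Prod>j\<in>UNIV. ?f j (g j))"
    unfolding grid_index_eq sum.reindex[OF inj]
    by (simp add: freq_pairing_def grid_point_def exp_sum[symmetric] sum_distrib_left)
  also have "\<dots> = (\<Prod>j\<in>UNIV. \<Sum>t\<in>{0..<int (N $ j)}. ?f j t)"
    by (rule prod_sum_PiE[symmetric]) auto
  also have "\<dots> = (\<Prod>j\<in>UNIV. if int (N $ j) dvd k $ j then of_nat (N $ j) else 0)"
    by (simp only: sum_roots_of_unity[OF assms])
  also have "\<dots> = (if \<forall>j. int (N $ j) dvd k $ j then of_nat (\<Prod>j\<in>UNIV. N $ j) else 0)"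
    by auto
  finally show ?thesis .
qed

lemma inj_on_grid_point: "inj_on (grid_point N) (grid_index N)" if "\<And>j. N $ j > 0"
  by (auto simp: inj_on_def grid_point_def vec_eq_iff less_not_refl2[OF that])

lemma mscale_nth: "mscale c X $ i $ j = c * X $ i $ j"
  by (simp add: mscale_def)

lemma linear_mscale: "linear (mscale c)"
  by (rule linearI) (simp_all add: mscale_def vec_eq_iff distrib_left)

lemma inner_mscale: "mscale c X \<bullet> Y = X \<bullet> mscale (cnj c) Y"
  by (simp add: inner_vec_def mscale_def inner_complex_def algebra_simps)

lemma linear_trig_poly: "linear (\<lambda>Q. trig_poly idx Q \<theta>)"
  unfolding trig_poly_def
  by (intro linear_compose_sum ballI linear_compose[OF _ linear_mscale, unfolded comp_def]) (auto intro: linearI)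

text \<open>Two frequencies differ by less than \<open>N $ j\<close> in each coordinate, so
  divisibility of all differences forces equality. The characters are therefore orthonormal on the
  grid and the moments return the coefficients.\<close>

lemma moments_trig_poly:
  fixes N :: "nat^'d" and idx :: "'k::finite \<Rightarrow> int^'d"
  assumes N: "\<And>j. N $ j > 0" and inj: "inj idx"
    and small: "\<And>a b j. \<bar>idx a $ j - idx b $ j\<bar> < int (N $ j)"
  shows "moments idx N (trig_poly idx Q) = Q"
proof -
  let ?n = "\<Prod>j\<in>UNIV. N $ j"
  have n: "?n > 0" using N by (simp add: prod_pos)
  have orth: "(\<Sum>l\<in>grid_index N. exp (\<i> * of_real (freq_pairing (idx a) (grid_point N l)))
       * exp (- (\<i> * of_real (freq_pairing (idx b) (grid_point N l)))))
     = (if a = b then of_nat ?n else 0)" for a b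
  proof -
    have "exp (\<i> * of_real (freq_pairing (idx a) \<theta>)) * exp (- (\<i> * of_real (freq_pairing (idx b) \<theta>)))
      = exp (\<i> * of_real (freq_pairing (idx a - idx b) \<theta>))" for \<theta>
      by (simp add: exp_add[symmetric] freq_pairing_def left_diff_distrib sum_subtractf right_diff_distrib)
    then have "(\<Sum>l\<in>grid_index N. exp (\<i> * of_real (freq_pairing (idx a) (grid_point N l)))
       * exp (- (\<i> * of_real (freq_pairing (idx b) (grid_point N l)))))
     = (if \<forall>j. int (N $ j) dvd (idx a - idx b) $ j then of_nat ?n else 0)"
      by (simp only: sum_characters_grid[OF N])
    moreover have "(\<forall>j. int (N $ j) dvd (idx a - idx b) $ j) \<longleftrightarrow> a = b"
    proof
      assume dvd: "\<forall>j. int (N $ j) dvd (idx a - idx b) $ j"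
      have "(idx a - idx b) $ j = 0" for j
        using dvd small[of a j b] zdvd_not_zless[of "\<bar>(idx a - idx b) $ j\<bar>" "int (N $ j)"]
        by (auto simp: not_less)
      then have "idx a = idx b" by (simp add: vec_eq_iff)
      then show "a = b" using inj by (simp add: inj_eq)
    qed simp
    ultimately show ?thesis by simp
  qed
  have "moments idx N (trig_poly idx Q) $ a $ i $ j = Q $ a $ i $ j" for a i j
  proof -
    let ?e = "\<lambda>a l. exp (\<i> * of_real (freq_pairing (idx a) (grid_point N l)))"
    let ?e' = "\<lambda>a l. exp (- (\<i> * of_real (freq_pairing (idx a) (grid_point N l))))"
    have "moments idx N (trig_poly idx Q) $ a $ i $ j
      = (1 / real ?n) *\<^sub>R (\<Sum>l\<in>grid_index N. ?e a l * (\<Sum>b\<in>UNIV. ?e' b l * Q $ b $ i $ j))"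
      by (simp add: moments_def grid_average_def trig_poly_def mscale_nth)
    also have "(\<Sum>l\<in>grid_index N. ?e a l * (\<Sum>b\<in>UNIV. ?e' b l * Q $ b $ i $ j))
      = (\<Sum>b\<in>UNIV. (\<Sum>l\<in>grid_index N. ?e a l * ?e' b l) * Q $ b $ i $ j)"
      unfolding sum_distrib_left sum_distrib_right mult.assoc by (rule sum.swap)
    also have "\<dots> = of_nat ?n * Q $ a $ i $ j"
      unfolding orth by (simp add: if_distrib[of "\<lambda>x. x * _"] cong: if_cong)
    also have "(1 / real ?n) *\<^sub>R \<dots> = Q $ a $ i $ j"
      using n by (simp add: scaleR_conv_of_real)
    finally show ?thesis .
  qed
  then show ?thesis by (simp add: vec_eq_iff)
qed

section \<open>The moment map\<close>

text \<open>For Hermitian A the inner product Re tr(A* B) is Re tr(A B), expressed here through the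
  identity matrix. It evaluates the pairing of a matrix with its inverse.\<close>

lemma inner_eq_trace_mult:
  assumes "ctranspose A = A"
  shows "A \<bullet> B = mat 1 \<bullet> (A ** B)"
proof -
  have "mat 1 \<bullet> (A ** B) = (\<Sum>i\<in>UNIV. Re ((A ** B) $ i $ i))"
    by (simp add: inner_vec_def mat_def inner_complex_def if_distrib[of Re] if_distrib[of Im]
        if_distrib[of "\<lambda>x. x * _"] cong: if_cong)
  also have "\<dots> = (\<Sum>i\<in>UNIV. \<Sum>j\<in>UNIV. A $ j $ i \<bullet> B $ j $ i)"
  proof -
    have "Re (A $ i $ j * z) = A $ j $ i \<bullet> z" for i j z
      by (subst herm_entry[OF assms, of j i, symmetric]) (simp add: inner_complex_def)
    then show ?thesis by (simp add: matrix_matrix_mult_def)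
  qed
  also have "\<dots> = A \<bullet> B"
    by (subst sum.swap) (simp add: inner_vec_def)
  finally show ?thesis by simp
qed

text \<open>Operators form a second algebra of this kind, so that inverting the derivative of omega
  is also a smooth operation.\<close>

lemma unital_bilinear_blinfun_compose:
  "unital_bilinear ((o\<^sub>L) :: ('e::real_normed_vector \<Rightarrow>\<^sub>L 'e) \<Rightarrow> ('e \<Rightarrow>\<^sub>L 'e) \<Rightarrow> ('e \<Rightarrow>\<^sub>L 'e)) id_blinfun"
  by (rule unital_bilinear.intro[OF bounded_bilinear_blinfun_compose])
    (unfold_locales, auto intro: blinfun_eqI)

interpretation compose: unital_bilinear
  "(o\<^sub>L) :: ('e::real_normed_vector \<Rightarrow>\<^sub>L 'e) \<Rightarrow> ('e \<Rightarrow>\<^sub>L 'e) \<Rightarrow> ('e \<Rightarrow>\<^sub>L 'e)" id_blinfun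
  by (rule unital_bilinear_blinfun_compose)

text \<open>\<open>T l Q\<close> stands for the value of the polynomial \<open>Q\<close> at the grid point \<open>l\<close>, \<open>P l\<close> for \<open>\<Psi>\<^sup>-\<^sup>1\<close>
  there, and \<open>E l X\<close> for the moments of the function that is \<open>X\<close> at \<open>l\<close> and zero elsewhere, so
  \<open>E\<close> absorbs the weight \<open>c = 1/|N|\<close> of the average. \<open>J\<close> is the family with polynomial \<open>1\<close>.\<close>

locale moment_map =
  fixes I :: "'i set"
    and T :: "'i \<Rightarrow> 'e::euclidean_space \<Rightarrow> complex^'m^'m"
    and E :: "'i \<Rightarrow> complex^'m^'m \<Rightarrow> 'e"
    and V :: "'e set"
    and P :: "'i \<Rightarrow> complex^'m^'m"
    and J :: 'e
    and c :: real
  assumes finite_I: "finite I"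
    and c_pos: "c > 0"
    and linear_T: "\<And>l. linear (T l)"
    and linear_E: "\<And>l. linear (E l)"
    and adjoint: "\<And>l X Q. E l X \<bullet> Q = c * (X \<bullet> T l Q)"
    and reconstruct: "\<And>Q. (\<Sum>l\<in>I. E l (T l Q)) = Q"
    and subspace_V: "subspace V"
    and T_herm: "\<And>l Q. l \<in> I \<Longrightarrow> Q \<in> V \<Longrightarrow> ctranspose (T l Q) = T l Q"
    and E_in_V: "\<And>l X. l \<in> I \<Longrightarrow> ctranspose X = X \<Longrightarrow> E l X \<in> V"
    and T_J: "\<And>l. l \<in> I \<Longrightarrow> T l J = mat 1"
    and P_posdef: "\<And>l. l \<in> I \<Longrightarrow> herm_posdef (P l)"
begin

section \<open>Grid values, their inverses, domain and target\<close>

definition A :: "'i \<Rightarrow> 'e \<Rightarrow> complex^'m^'m" where "A l Q = P l + T l Q"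
definition B :: "'i \<Rightarrow> 'e \<Rightarrow> complex^'m^'m" where "B l Q = matrix_inv (A l Q)"
definition \<Gamma> :: "('i \<Rightarrow> complex^'m^'m) \<Rightarrow> 'e" where "\<Gamma> F = (\<Sum>l\<in>I. E l (F l))"
definition Lp :: "'e set" where "Lp = {Q \<in> V. \<forall>l\<in>I. herm_posdef (A l Q)}"
definition Mp :: "'e set" where "Mp = {\<Gamma> F | F. \<forall>l\<in>I. herm_posdef (F l)}"
definition om :: "'e \<Rightarrow> 'e" where "om Q = \<Gamma> (\<lambda>l. B l Q)"

lemmas T_bounded_linear = linear_T[unfolded linear_conv_bounded_linear]
lemmas E_bounded_linear = linear_E[unfolded linear_conv_bounded_linear]

lemma Lp_posdef: "Q \<in> Lp \<Longrightarrow> l \<in> I \<Longrightarrow> herm_posdef (A l Q)" by (simp add: Lp_def)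
lemma Lp_in_V: "Q \<in> Lp \<Longrightarrow> Q \<in> V" by (simp add: Lp_def)
lemma B_posdef: "Q \<in> Lp \<Longrightarrow> l \<in> I \<Longrightarrow> herm_posdef (B l Q)"
  by (simp add: B_def herm_posdef_matrix_inv Lp_posdef)
lemma A_B: "Q \<in> Lp \<Longrightarrow> l \<in> I \<Longrightarrow> A l Q ** B l Q = mat 1"
  by (simp add: B_def herm_posdef_inverse Lp_posdef)
lemma B_A: "Q \<in> Lp \<Longrightarrow> l \<in> I \<Longrightarrow> B l Q ** A l Q = mat 1"
  by (simp add: B_def herm_posdef_inverse Lp_posdef)

lemma \<Gamma>_inner: "\<Gamma> F \<bullet> Q = c * (\<Sum>l\<in>I. F l \<bullet> T l Q)"
  by (simp add: \<Gamma>_def inner_sum_left adjoint sum_distrib_left)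

text \<open>By reconstruction, a polynomial that vanishes on the whole grid has zero
  coefficients.\<close>

lemma T_separates:
  assumes "v \<noteq> 0"
  shows "\<exists>l\<in>I. T l v \<noteq> 0"
proof (rule ccontr)
  assume "\<not> ?thesis"
  then have "v = (\<Sum>l\<in>I. E l 0)" using reconstruct[of v] by (metis (no_types, lifting) sum.cong)
  then show False using assms by (simp add: linear_0[OF linear_E])
qed

lemma Mp_subset_V: "Mp \<subseteq> V"
  unfolding Mp_def \<Gamma>_def
  by (auto intro!: subspace_sum[OF subspace_V] E_in_V simp: herm_posdef_iff)

lemma om_in_Mp: "Q \<in> Lp \<Longrightarrow> om Q \<in> Mp"
  using B_posdef by (auto simp: Mp_def om_def)

text \<open>By the resolvent identity \<open>\<omega>(Q) - \<omega>(Q')\<close> is the image of \<open>Q - Q'\<close> under this operator, which is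
  the derivative of \<open>\<omega>\<close> when \<open>Q = Q'\<close>.\<close>

definition Lop :: "'e \<Rightarrow> 'e \<Rightarrow> 'e \<Rightarrow>\<^sub>L 'e" where
  "Lop Q Q' = Blinfun (\<lambda>v. - \<Gamma> (\<lambda>l. B l Q ** T l v ** B l Q'))"

lemma Lop_apply: "Lop Q Q' v = - \<Gamma> (\<lambda>l. B l Q ** T l v ** B l Q')"
proof -
  have "bounded_linear (\<lambda>v. - \<Gamma> (\<lambda>l. B l Q ** T l v ** B l Q'))"
    unfolding \<Gamma>_def
    by (intro bounded_linear_minus bounded_linear_sum bounded_linear_compose[OF E_bounded_linear]
      bounded_linear_compose[OF matrix.bounded_linear_left]
      bounded_linear_compose[OF matrix.bounded_linear_right] T_bounded_linear)
  then show ?thesis by (simp add: Lop_def bounded_linear_Blinfun_apply)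
qed

section \<open>Resolvent identity and injectivity\<close>

text \<open>The resolvent identity at each grid point; \<open>P l\<close> cancels from the
  difference of the two values of \<open>A l\<close>.\<close>

lemma om_diff:
  assumes "Q \<in> Lp" "Q' \<in> Lp"
  shows "om Q - om Q' = Lop Q Q' (Q - Q')"
proof -
  have "B l Q - B l Q' = - (B l Q ** T l (Q - Q') ** B l Q')" if "l \<in> I" for l
    using matrix.inverse_diff[OF A_B[OF assms(2) that] B_A[OF assms(1) that]]
    by (simp add: A_def linear_diff[OF linear_T])
  then show ?thesis
    by (simp add: om_def Lop_apply \<Gamma>_def linear_diff[OF linear_E, symmetric]
        linear_neg[OF linear_E] flip: sum_subtractf sum_negf)
qed

text \<open>Adjointness turns the pairing with v into a negative multiple of a sum of sandwich
  forms. Each is nonnegative, and one is positive at a grid point where v does not vanish.\<close>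

lemma Lop_negative:
  assumes Q: "Q \<in> Lp" "Q' \<in> Lp" and v: "v \<noteq> 0"
  shows "Lop Q Q' v \<bullet> v < 0"
proof -
  obtain l0 where l0: "l0 \<in> I" "T l0 v \<noteq> 0" using T_separates[OF v] by blast
  have pos: "0 < (B l Q ** T l v ** B l Q') \<bullet> T l v" if "l \<in> I" "T l v \<noteq> 0" for l
    using inner_sandwich_pos[OF B_posdef[OF Q(1) that(1)] B_posdef[OF Q(2) that(1)] that(2)]
    by (simp add: inner_commute)
  have "0 < (\<Sum>l\<in>I. (B l Q ** T l v ** B l Q') \<bullet> T l v)"
  proof (rule sum_pos2[OF finite_I l0(1)])
    show "0 < (B l0 Q ** T l0 v ** B l0 Q') \<bullet> T l0 v" by (rule pos[OF l0])
    show "0 \<le> (B l Q ** T l v ** B l Q') \<bullet> T l v" if "l \<in> I" for l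
      using pos[OF that] by (cases "T l v = 0") auto
  qed
  then show ?thesis using c_pos by (simp add: Lop_apply \<Gamma>_inner)
qed

text \<open>Equal images would make the definite form of \<open>Lop Q Q'\<close> vanish at
  \<open>Q - Q'\<close>.\<close>

lemma om_inj: "inj_on om Lp"
proof (rule inj_onI, rule ccontr)
  fix Q Q' assume "Q \<in> Lp" "Q' \<in> Lp" "om Q = om Q'" "Q \<noteq> Q'"
  then show False using om_diff[of Q Q'] Lop_negative[of Q Q' "Q - Q'"] by simp
qed

section \<open>Smoothness of the map and of its inverse\<close>

text \<open>Definiteness on the whole space gives injectivity, hence invertibility in finite
  dimension. Distinct arguments are allowed because the exact slopes of the inverse need
  them.\<close>

lemma Lop_invertible:
  assumes "Q \<in> Lp" "Q' \<in> Lp"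
  shows "\<exists>M. M o\<^sub>L Lop Q Q' = id_blinfun \<and> Lop Q Q' o\<^sub>L M = id_blinfun"
proof -
  have lin: "linear (Lop Q Q')" by (simp add: blinfun.bounded_linear_right bounded_linear.linear)
  have "inj (Lop Q Q')"
    using Lop_negative[OF assms] by (subst linear_injective_0[OF lin]) force
  then obtain f' where f': "linear f'" "\<forall>x. f' (Lop Q Q' x) = x" "\<forall>x. Lop Q Q' (f' x) = x"
    using linear_injective_isomorphism[OF lin] by blast
  then have "bounded_linear f'" by (simp add: linear_conv_bounded_linear)
  then have "Blinfun f' o\<^sub>L Lop Q Q' = id_blinfun \<and> Lop Q Q' o\<^sub>L Blinfun f' = id_blinfun"
    using f' by (auto intro!: blinfun_eqI simp: bounded_linear_Blinfun_apply)
  then show ?thesis by blast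
qed

definition Linv :: "'e \<Rightarrow> 'e \<Rightarrow> 'e \<Rightarrow>\<^sub>L 'e" where
  "Linv Q Q' = (SOME M. M o\<^sub>L Lop Q Q' = id_blinfun \<and> Lop Q Q' o\<^sub>L M = id_blinfun)"

lemma Linv:
  assumes "Q \<in> Lp" "Q' \<in> Lp"
  shows "Linv Q Q' o\<^sub>L Lop Q Q' = id_blinfun" "Lop Q Q' o\<^sub>L Linv Q Q' = id_blinfun"
  using someI_ex[OF Lop_invertible[OF assms]] by (auto simp: Linv_def)

lemma Ck_on_B:
  assumes "Ck_on n W S G" and "\<And>x. x \<in> S \<Longrightarrow> G x \<in> Lp" and "l \<in> I"
  shows "Ck_on n W S (\<lambda>x. B l (G x))"
proof (rule matrix.Ck_on_inverse)
  show "Ck_on n W S (\<lambda>x. A l (G x))"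
    unfolding A_def using Ck_on_add[OF Ck_on_const Ck_on_bounded_linear[OF T_bounded_linear assms(1)]] .
qed (use A_B B_A assms in auto)

lemma Ck_on_om: "Ck_on n W Lp om"
  unfolding om_def \<Gamma>_def
  by (rule Ck_on_sum, rule Ck_on_bounded_linear[OF E_bounded_linear], rule Ck_on_B[OF Ck_on_ident])

lemma Ck_on_Lop:
  assumes "Ck_on n W S G" "Ck_on n W S G'"
    and "\<And>x. x \<in> S \<Longrightarrow> G x \<in> Lp" "\<And>x. x \<in> S \<Longrightarrow> G' x \<in> Lp"
  shows "Ck_on n W S (\<lambda>x. Lop (G x) (G' x))"
proof (rule Ck_on_blinfunI)
  fix b :: 'e
  have "Ck_on n W S (\<lambda>x. B l (G x) ** T l b ** B l (G' x))" if "l \<in> I" for l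
    by (rule Ck_on_bounded_bilinear[OF matrix.bounded_bilinear_axioms
        Ck_on_bounded_linear[OF matrix.bounded_linear_left Ck_on_B[OF assms(1,3) that]]
        Ck_on_B[OF assms(2,4) that]])
  then have "Ck_on n W S (\<lambda>x. \<Sum>l\<in>I. E l (B l (G x) ** T l b ** B l (G' x)))"
    by (rule Ck_on_sum[OF Ck_on_bounded_linear[OF E_bounded_linear]])
  then show "Ck_on n W S (\<lambda>x. Lop (G x) (G' x) b)"
    unfolding Lop_apply \<Gamma>_def by (rule Ck_on_bounded_linear[OF bounded_linear_minus[OF bounded_linear_ident]])
qed

lemma Ck_on_Linv:
  assumes "Ck_on n W S G" "Ck_on n W S G'"
    and "\<And>x. x \<in> S \<Longrightarrow> G x \<in> Lp" "\<And>x. x \<in> S \<Longrightarrow> G' x \<in> Lp"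
  shows "Ck_on n W S (\<lambda>x. Linv (G x) (G' x))"
  by (rule compose.Ck_on_inverse[OF Ck_on_Lop[OF assms]]) (simp_all add: Linv assms(3,4))

text \<open>Inverting the identity for differences of omega makes \<open>Linv (G z) (G y)\<close> an
  exact slope of G, continuous in z. The derivative at y is then \<open>Linv (G y) (G y)\<close>, as
  smooth as G, and the order of smoothness climbs by induction.\<close>

lemma Ck_on_om_inverse:
  assumes cont: "continuous_on S G" and G: "\<And>y. y \<in> S \<Longrightarrow> G y \<in> Lp" "\<And>y. y \<in> S \<Longrightarrow> om (G y) = y"
  shows "Ck_on n W S G"
proof (induction n)
  case 0
  show ?case using cont by simp
next
  case (Suc n)
  have "(G has_derivative Linv (G y) (G y)) (at y within S)" if y: "y \<in> S" for y
  proof (rule has_derivative_CaratheodoryI[where F = "\<lambda>z. Linv (G z) (G y)"])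
    fix z assume z: "z \<in> S"
    have "z - y = Lop (G z) (G y) (G z - G y)"
      using om_diff[OF G(1)[OF z] G(1)[OF y]] G(2) y z by simp
    then have "Linv (G z) (G y) (z - y) = (Linv (G z) (G y) o\<^sub>L Lop (G z) (G y)) (G z - G y)" by simp
    then show "G z - G y = Linv (G z) (G y) (z - y)"
      using Linv(1)[OF G(1)[OF z] G(1)[OF y]] by simp
  next
    have "Ck_on 0 W S (\<lambda>z. Linv (G z) (G y))"
      using cont by (intro Ck_on_Linv Ck_on_const G y) simp
    then show "((\<lambda>z. Linv (G z) (G y)) \<longlongrightarrow> Linv (G y) (G y)) (at y within S)"
      using y by (simp add: continuous_on_def)
  qed
  moreover have "Ck_on n W S (\<lambda>y. Linv (G y) (G y) v)" for v
    by (rule Ck_on_bounded_linear[OF blinfun.bounded_linear_left]) (intro Ck_on_Linv Suc G)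
  ultimately show ?case unfolding Ck_on.simps
    by (intro exI[where x = "\<lambda>y. blinfun_apply (Linv (G y) (G y))"] conjI ballI)
qed

section \<open>Topology of domain and target\<close>

lemma A_herm: "Q \<in> V \<Longrightarrow> l \<in> I \<Longrightarrow> ctranspose (A l Q) = A l Q"
  using P_posdef T_herm by (simp add: A_def ctranspose_add herm_posdef_iff)

lemma continuous_A: "continuous_on UNIV (A l)"
  unfolding A_def by (intro continuous_intros bounded_linear.continuous_on[OF T_bounded_linear])

text \<open>Finitely many open conditions; the symmetry that they presuppose holds throughout
  \<open>V\<close>.\<close>

lemma openin_Lp: "openin (top_of_set V) Lp"
  unfolding openin_euclidean_subtopology_iff
proof (intro conjI ballI)
  show "Lp \<subseteq> V" using Lp_in_V by blast
  fix Q assume Q: "Q \<in> Lp"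
  have "\<exists>e>0. \<forall>Q'\<in>V. dist Q' Q < e \<longrightarrow> herm_posdef (A l Q')" if l: "l \<in> I" for l
  proof -
    obtain e where e: "e > 0" "\<forall>X. ctranspose X = X \<longrightarrow> dist X (A l Q) < e \<longrightarrow> herm_posdef X"
      using herm_posdef_near[OF Lp_posdef[OF Q l]] by blast
    obtain d where "d > 0" "\<forall>Q'. dist Q' Q < d \<longrightarrow> dist (A l Q') (A l Q) < e"
      using continuous_A[of l] e(1) unfolding continuous_on_iff by (metis UNIV_I)
    then show ?thesis using e(2) A_herm l by blast
  qed
  then obtain e where e: "\<And>l. l \<in> I \<Longrightarrow> e l > 0 \<and> (\<forall>Q'\<in>V. dist Q' Q < e l \<longrightarrow> herm_posdef (A l Q'))"
    by metis
  \<comment> \<open>The inserted 1 makes the minimum meaningful even over an empty index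
    set.\<close>
  define d where "d = Min (insert 1 (e ` I))"
  have "d > 0" using e finite_I by (simp add: d_def)
  moreover have "d \<le> e l" if "l \<in> I" for l using that finite_I by (simp add: d_def)
  ultimately have "\<forall>Q'\<in>V. dist Q' Q < d \<longrightarrow> Q' \<in> Lp" unfolding Lp_def using e by fastforce
  then show "\<exists>e>0. \<forall>x'\<in>V. dist x' Q < e \<longrightarrow> x' \<in> Lp" using \<open>d > 0\<close> by blast
qed

text \<open>Invariance of domain for an injective continuous map from an open part of
  \<open>V\<close> into \<open>V\<close>. All relatively open \<open>U\<close> are covered, since
  continuity of the inverse needs an open map.\<close>

lemma openin_om_image:
  assumes "openin (top_of_set Lp) U"
  shows "openin (top_of_set V) (om ` U)"
proof (rule invariance_of_domain_subspaces[OF _ subspace_V subspace_V order_refl])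
  show "openin (top_of_set V) U" using assms openin_Lp openin_trans by blast
  have U: "U \<subseteq> Lp" using assms openin_imp_subset by blast
  show "continuous_on U om" using Ck_on_imp_continuous_on[OF Ck_on_om[of 0 UNIV]] U continuous_on_subset by blast
  show "inj_on om U" using om_inj U inj_on_subset by blast
  show "om \<in> U \<rightarrow> V" using om_in_Mp Mp_subset_V U by blast
qed

text \<open>Positive definite matrices form a convex cone and the moments are linear. Convexity is
  what makes the target connected.\<close>

lemma convex_Mp: "convex Mp"
  unfolding convex_alt
proof (intro ballI allI impI)
  fix x y u assume "x \<in> Mp" "y \<in> Mp" and u: "0 \<le> u \<and> u \<le> (1::real)"
  then obtain F G where F: "x = \<Gamma> F" "\<forall>l\<in>I. herm_posdef (F l)"
    and G: "y = \<Gamma> G" "\<forall>l\<in>I. herm_posdef (G l)" by (auto simp: Mp_def)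
  let ?H = "\<lambda>l. (1 - u) *\<^sub>R F l + u *\<^sub>R G l"
  have "herm_posdef (?H l)" if l: "l \<in> I" for l
    unfolding herm_posdef_iff
  proof (intro conjI allI impI)
    show "ctranspose (?H l) = ?H l"
      using F(2) G(2) l by (simp add: ctranspose_add ctranspose_scaleR herm_posdef_iff)
    fix z :: "complex^'m" assume "z \<noteq> 0"
    then have "0 < z \<bullet> (F l *v z)" "0 < z \<bullet> (G l *v z)" using F(2) G(2) l by (auto simp: herm_posdef_iff)
    then have "0 < (1 - u) * (z \<bullet> (F l *v z)) + u * (z \<bullet> (G l *v z))"
      \<comment> \<open>For u = 0 only the first term is positive; otherwise the second one
        is.\<close>
      using u by (cases "u = 0") (auto intro: add_nonneg_pos)
    then show "0 < z \<bullet> (?H l *v z)"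
      by (simp add: mvec.add_left mvec.scaleR_left inner_add_right)
  qed
  moreover have "(1 - u) *\<^sub>R x + u *\<^sub>R y = \<Gamma> ?H"
    by (simp add: F G \<Gamma>_def linear_add[OF linear_E] linear_cmul[OF linear_E] sum.distrib scaleR_sum_right)
  ultimately show "(1 - u) *\<^sub>R x + u *\<^sub>R y \<in> Mp" by (auto simp: Mp_def)
qed

section \<open>Compactness and closedness of the image\<close>

lemma inner_lower_bound_uniform:
  assumes "\<And>l. l \<in> I \<Longrightarrow> herm_posdef (F l)"
  shows "\<exists>d>0. \<forall>l\<in>I. \<forall>X. herm_psd X \<longrightarrow> d * norm X \<le> F l \<bullet> X"
proof -
  obtain e where e: "\<And>l. l \<in> I \<Longrightarrow> e l > 0 \<and> (\<forall>X. herm_psd X \<longrightarrow> e l * norm X \<le> F l \<bullet> X)"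
    using herm_posdef_inner_lower_bound[OF assms] by metis
  define d where "d = Min (insert 1 (e ` I))"
  have "d > 0" using e finite_I by (simp add: d_def)
  moreover have "d \<le> e l" if "l \<in> I" for l using that finite_I by (simp add: d_def)
  ultimately show ?thesis using e by (meson mult_right_mono norm_ge_zero order_trans)
qed

lemma mat1_posdef: "herm_posdef (mat 1)"
  by (simp add: herm_posdef_iff ctranspose_mat1)

text \<open>The quantity \<open>\<langle>\<omega>(Q), Q\<rangle>\<close> is bounded above because \<open>tr(A\<^sup>-\<^sup>1 A) = m\<close>, while \<open>\<langle>\<Gamma>(\<Phi>), Q\<rangle>\<close>
  grows linearly in \<open>Q\<close> on \<open>Lp\<close>. So \<open>Q\<close> stays bounded when \<open>\<omega>(Q)\<close> tends to \<open>\<Gamma>(\<Phi>)\<close>.\<close>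

lemma preimages_bounded:
  assumes Q: "\<And>n. Q n \<in> Lp" and lim: "(\<lambda>n. om (Q n)) \<longlonglongrightarrow> y" and y: "y \<in> Mp"
  shows "\<exists>R n0. \<forall>n\<ge>n0. norm (Q n) \<le> R"
proof -
  obtain F where F: "y = \<Gamma> F" "\<And>l. l \<in> I \<Longrightarrow> herm_posdef (F l)" using y by (auto simp: Mp_def)
  obtain d where d: "d > 0" "\<And>l X. l \<in> I \<Longrightarrow> herm_psd X \<Longrightarrow> d * norm X \<le> F l \<bullet> X"
    using inner_lower_bound_uniform[of F] F(2) by blast
  \<comment> \<open>Size is measured by the grid values of \<open>A\<close>, to which the positivity
    estimates apply; \<open>normQ\<close> converts back to the norm of the family.\<close>
  define a where "a n = (\<Sum>l\<in>I. norm (A l (Q n)))" for n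
  define p where "p = (\<Sum>l\<in>I. norm (P l))"
  obtain k where k: "\<And>l X. norm (E l X) \<le> norm X * k l" "\<And>l. 0 \<le> k l"
    using bounded_linear.nonneg_bounded[OF E_bounded_linear] by metis
  define K where "K = (\<Sum>l\<in>I. k l)"
  have K0: "K \<ge> 0" using k(2) by (simp add: K_def sum_nonneg)
  have normQ: "norm (Q n) \<le> K * (a n + p)" for n
  proof -
    have "norm (Q n) \<le> (\<Sum>l\<in>I. norm (E l (T l (Q n))))"
      using norm_sum[of "\<lambda>l. E l (T l (Q n))" I] by (simp add: reconstruct)
    also have "\<dots> \<le> (\<Sum>l\<in>I. (a n + p) * k l)"
    proof (rule sum_mono)
      fix l assume l: "l \<in> I"
      have "norm (T l (Q n)) \<le> norm (A l (Q n)) + norm (P l)"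
        using norm_triangle_ineq4[of "A l (Q n)" "P l"] by (simp add: A_def)
      also have "\<dots> \<le> a n + p"
        unfolding a_def p_def using l finite_I by (intro add_mono member_le_sum) auto
      finally have "norm (T l (Q n)) * k l \<le> (a n + p) * k l" using k(2) by (intro mult_right_mono)
      then show "norm (E l (T l (Q n))) \<le> (a n + p) * k l" using k(1) order_trans by blast
    qed
    also have "\<dots> = K * (a n + p)" by (simp add: K_def flip: sum_distrib_left)
    finally show ?thesis .
  qed
  define C1 where "C1 = c * (\<Sum>l\<in>I. mat 1 \<bullet> (mat 1 :: complex^'m^'m))"
  define C2 where "C2 = c * (\<Sum>l\<in>I. F l \<bullet> P l)"
  have upper: "om (Q n) \<bullet> Q n \<le> C1" for n
  proof -
    have "B l (Q n) \<bullet> T l (Q n) \<le> mat 1 \<bullet> (mat 1 :: complex^'m^'m)" if l: "l \<in> I" for l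
    proof -
      have "0 \<le> B l (Q n) \<bullet> P l"
        using herm_posdef_inner_lower_bound[OF B_posdef[OF Q l]] herm_posdef_imp_psd[OF P_posdef[OF l]]
        by (meson less_imp_le mult_nonneg_nonneg norm_ge_zero order_trans)
      moreover have "B l (Q n) \<bullet> A l (Q n) = mat 1 \<bullet> (mat 1 :: complex^'m^'m)"
        using inner_eq_trace_mult[of "B l (Q n)" "A l (Q n)"] B_posdef[OF Q l, of n] B_A[OF Q l]
        by (simp add: herm_posdef_iff)
      ultimately show ?thesis by (simp add: A_def inner_add_right)
    qed
    then show ?thesis unfolding om_def \<Gamma>_inner C1_def
      using c_pos by (intro mult_left_mono sum_mono) auto
  qed
  have lower: "c * d * a n - C2 \<le> y \<bullet> Q n" for n
  proof -
    have "(\<Sum>l\<in>I. d * norm (A l (Q n)) - F l \<bullet> P l) \<le> (\<Sum>l\<in>I. F l \<bullet> T l (Q n))"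
    proof (rule sum_mono)
      fix l assume l: "l \<in> I"
      have "d * norm (A l (Q n)) \<le> F l \<bullet> A l (Q n)"
        using d(2)[OF l] herm_posdef_imp_psd[OF Lp_posdef[OF Q l]] .
      then show "d * norm (A l (Q n)) - F l \<bullet> P l \<le> F l \<bullet> T l (Q n)"
        by (simp add: A_def inner_add_right)
    qed
    then have "c * (\<Sum>l\<in>I. d * norm (A l (Q n)) - F l \<bullet> P l) \<le> c * (\<Sum>l\<in>I. F l \<bullet> T l (Q n))"
      using c_pos by (intro mult_left_mono) auto
    then show ?thesis
      by (simp add: F(1) \<Gamma>_inner a_def C2_def sum_subtractf right_diff_distrib sum_distrib_left mult.assoc)
  qed
  have "(\<lambda>n. norm (om (Q n) - y) * K) \<longlonglongrightarrow> 0"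
    using tendsto_norm_zero[OF LIM_zero[OF lim]] by (rule tendsto_mult_left_zero)
  then have "\<forall>\<^sub>F n in sequentially. norm (om (Q n) - y) * K < c * d / 2"
    by (rule order_tendstoD) (use c_pos d in simp)
  \<comment> \<open>Half of the growth rate \<open>c * d\<close> from \<open>lower\<close> pays for
    the error \<open>om (Q n) - y\<close>; the other half still bounds \<open>a n\<close>.\<close>
  then obtain n0 where n0: "\<And>n. n \<ge> n0 \<Longrightarrow> norm (om (Q n) - y) * K < c * d / 2"
    by (auto simp: eventually_sequentially)
  have "norm (Q n) \<le> K * ((C1 + C2 + c * d / 2 * p) / (c * d / 2) + p)" if n: "n \<ge> n0" for n
  proof -
    have ap: "a n + p \<ge> 0" by (simp add: a_def p_def sum_nonneg)
    have "y \<bullet> Q n - om (Q n) \<bullet> Q n \<le> norm (y - om (Q n)) * norm (Q n)"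
      unfolding inner_diff_left[symmetric] by (rule norm_cauchy_schwarz)
    also have "\<dots> \<le> norm (y - om (Q n)) * (K * (a n + p))"
      using normQ by (intro mult_left_mono) auto
    also have "\<dots> = (norm (om (Q n) - y) * K) * (a n + p)"
      by (simp add: norm_minus_commute)
    also have "\<dots> \<le> (c * d / 2) * (a n + p)"
      using n0[OF n] ap by (intro mult_right_mono) auto
    finally have "c * d / 2 * a n \<le> C1 + C2 + c * d / 2 * p"
      using upper[of n] lower[of n] by (simp add: distrib_left)
    then have "a n \<le> (C1 + C2 + c * d / 2 * p) / (c * d / 2)"
      using c_pos d(1) by (simp add: pos_le_divide_eq mult.commute)
    then have "K * (a n + p) \<le> K * ((C1 + C2 + c * d / 2 * p) / (c * d / 2) + p)"
      using K0 by (intro mult_left_mono) auto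
    then show ?thesis using normQ[of n] by linarith
  qed
  then show ?thesis by blast
qed

text \<open>Pairing omega(Q) with \<open>J\<close> gives c times the sum of the traces of the
  \<open>B l Q\<close>. These are nonnegative, and the trace of a positive semidefinite matrix
  controls its norm.\<close>

lemma B_bounded:
  assumes Q: "\<And>n. Q n \<in> Lp" and lim: "(\<lambda>n. om (Q n)) \<longlonglongrightarrow> y"
  shows "\<exists>K. \<forall>n. \<forall>l\<in>I. norm (B l (Q n)) \<le> K"
proof -
  obtain M where M: "\<And>n. norm (om (Q n)) \<le> M"
    using convergent_imp_bounded[OF lim] by (auto simp: bounded_iff)
  obtain d where d: "d > 0" "\<And>X :: complex^'m^'m. herm_psd X \<Longrightarrow> d * norm X \<le> mat 1 \<bullet> X"
    using herm_posdef_inner_lower_bound[OF mat1_posdef] by blast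
  have "norm (B l (Q n)) \<le> M * norm J / (c * d)" if l: "l \<in> I" for n l
  proof -
    have psd: "herm_psd (B j (Q n))" if "j \<in> I" for j
      using herm_posdef_imp_psd B_posdef Q that by blast
    have nonneg: "0 \<le> B j (Q n) \<bullet> mat 1" if "j \<in> I" for j
    proof -
      have "0 \<le> d * norm (B j (Q n))" using d(1) by simp
      also have "\<dots> \<le> mat 1 \<bullet> B j (Q n)" by (rule d(2)[OF psd[OF that]])
      finally show ?thesis by (simp add: inner_commute)
    qed
    have "c * (d * norm (B l (Q n))) \<le> c * (B l (Q n) \<bullet> mat 1)"
      using c_pos d(2)[OF psd[OF l]] by (simp add: inner_commute)
    also have "\<dots> \<le> c * (\<Sum>j\<in>I. B j (Q n) \<bullet> mat 1)"
      using c_pos l finite_I nonneg by (intro mult_left_mono member_le_sum) auto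
    also have "\<dots> = om (Q n) \<bullet> J"
      by (simp add: om_def \<Gamma>_inner T_J)
    also have "\<dots> \<le> norm (om (Q n)) * norm J" by (rule norm_cauchy_schwarz)
    also have "\<dots> \<le> M * norm J" using M by (intro mult_right_mono) auto
    finally show ?thesis using c_pos d(1) by (simp add: field_simps)
  qed
  then show ?thesis by blast
qed

text \<open>Bounded preimages have a subsequence converging to some q in \<open>V\<close>. Bounded
  inverses keep q off the boundary of \<open>Lp\<close>, and continuity gives omega(q) = y.\<close>

lemma closedin_om_image: "closedin (top_of_set Mp) (om ` Lp)"
  unfolding closedin_limpt islimpt_sequential
proof (intro conjI allI impI)
  show "om ` Lp \<subseteq> Mp" using om_in_Mp by blast
  fix y assume "(\<exists>x. (\<forall>n. x n \<in> om ` Lp - {y}) \<and> x \<longlonglongrightarrow> y) \<and> y \<in> Mp"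
  then obtain x where as: "\<forall>n. x n \<in> om ` Lp" "x \<longlonglongrightarrow> y" "y \<in> Mp" by blast
  then have "\<forall>n. \<exists>q. q \<in> Lp \<and> x n = om q" by blast
  then obtain Q where Q: "\<And>n. Q n \<in> Lp" "\<And>n. x n = om (Q n)" by metis
  then have "x = (\<lambda>n. om (Q n))" by blast
  with as have lim: "(\<lambda>n. om (Q n)) \<longlonglongrightarrow> y" and y: "y \<in> Mp" by auto
  obtain R n0 where R: "\<And>n. n \<ge> n0 \<Longrightarrow> norm (Q n) \<le> R"
    using preimages_bounded[OF Q(1) lim y] by blast
  obtain K where K: "\<And>n l. l \<in> I \<Longrightarrow> norm (B l (Q n)) \<le> K"
    using B_bounded[OF Q(1) lim] by blast
  have "seq_compact (cball (0::'e) R)" by (simp add: compact_imp_seq_compact)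
  moreover have "\<forall>n. Q (n0 + n) \<in> cball 0 R" using R by simp
  ultimately obtain q r where r: "strict_mono r" and q: "((\<lambda>n. Q (n0 + n)) \<circ> r) \<longlonglongrightarrow> q"
    by (rule seq_compactE)
  \<comment> \<open>The shift by \<open>n0\<close> discards the terms for which no bound is
    known.\<close>
  define S where "S = (\<lambda>n. Q (n0 + r n))"
  have S: "S \<longlonglongrightarrow> q" "\<And>n. S n \<in> Lp" using q Q(1) by (simp_all add: S_def comp_def)
  have qV: "q \<in> V"
    using closed_sequentially[OF closed_subspace[OF subspace_V], of S q] S Lp_in_V by blast
  have "herm_posdef (A l q)" if l: "l \<in> I" for l
  proof (rule psd_injective_imp_posdef)
    have lim_A: "(\<lambda>n. A l (S n) *v v) \<longlonglongrightarrow> A l q *v v" for v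
      using continuous_on_tendsto_compose[OF continuous_A S(1)]
      by (intro mvec.tendsto tendsto_const) auto
    have "0 \<le> v \<bullet> (A l q *v v)" for v
      using herm_posdef_imp_psd[OF Lp_posdef[OF S(2) l]]
      by (intro tendsto_lowerbound[OF tendsto_inner[OF tendsto_const lim_A]]) (auto simp: herm_psd_def)
    then show "herm_psd (A l q)" using A_herm[OF qV l] by (simp add: herm_psd_def)
    \<comment> \<open>The estimate of v by \<open>A l (S n) *v v\<close>, uniform in n because the
      inverses are bounded, survives the limit and excludes a kernel.\<close>
    fix v assume v: "A l q *v v = 0"
    obtain D where D: "D > 0" "\<And>(X :: complex^'m^'m) z. norm (X *v z) \<le> norm X * norm z * D"
      using mvec.pos_bounded by blast
    have "norm v \<le> K * norm (A l (S n) *v v) * D" for n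
    proof -
      have "norm v = norm (B l (S n) *v (A l (S n) *v v))"
        by (simp add: matrix_vector_mul_assoc B_A[OF S(2) l])
      also have "\<dots> \<le> norm (B l (S n)) * norm (A l (S n) *v v) * D" by (rule D)
      also have "\<dots> \<le> K * norm (A l (S n) *v v) * D"
        using K[OF l] D(1) by (intro mult_right_mono) (auto simp: S_def)
      finally show ?thesis .
    qed
    moreover have "(\<lambda>n. K * norm (A l (S n) *v v) * D) \<longlonglongrightarrow> K * norm (A l q *v v) * D"
      by (intro tendsto_intros lim_A)
    ultimately have "norm v \<le> K * norm (A l q *v v) * D"
      by (intro tendsto_lowerbound) auto
    then show "v = 0" using v by simp
  qed
  then have qL: "q \<in> Lp" using qV by (simp add: Lp_def)
  have "(\<lambda>n. om (S n)) \<longlonglongrightarrow> om q"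
    using continuous_on_tendsto_compose[OF Ck_on_imp_continuous_on[OF Ck_on_om[of 0 UNIV]] S(1) qL] S(2)
    by simp
  moreover have "(\<lambda>n. om (S n)) \<longlonglongrightarrow> y"
    using LIMSEQ_subseq_LIMSEQ[OF lim, of "\<lambda>n. n0 + r n"] r
    by (simp add: strict_mono_def S_def comp_def)
  ultimately show "y \<in> om ` Lp" using LIMSEQ_unique qL by blast
qed

section \<open>Surjectivity and conclusion for the abstract map\<close>

lemma om_surj: "om ` Lp = Mp"
proof -
  \<comment> \<open>The zero family gives the values \<open>P l\<close>, so the image is a nonempty
    clopen subset of a connected set.\<close>
  have "0 \<in> Lp"
    using P_posdef by (simp add: Lp_def A_def linear_0[OF linear_T] subspace_0[OF subspace_V])
  then have "om ` Lp \<noteq> {}" by blast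
  moreover have "openin (top_of_set Mp) (om ` Lp)"
    by (rule openin_subset_trans[OF openin_om_image[OF openin_subtopology_self]])
      (use om_in_Mp Mp_subset_V in auto)
  ultimately show ?thesis
    using convex_connected[OF convex_Mp] closedin_om_image unfolding connected_clopen by blast
qed

theorem diffeomorphism_om: "diffeomorphism_between V Lp V Mp om"
  unfolding diffeomorphism_between_def
proof (intro conjI subspace_V openin_Lp)
  \<comment> \<open>Openness of the target is read off from surjectivity and the open mapping
    property.\<close>
  show "openin (top_of_set V) Mp"
    using openin_om_image[OF openin_subtopology_self] by (simp add: om_surj)
  show bij: "bij_betw om Lp Mp" by (simp add: bij_betw_def om_inj om_surj)
  show "smooth_map_on V Lp om" by (simp add: smooth_map_on_def Ck_on_om)
  let ?G = "inv_into Lp om"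
  have cont: "continuous_on Mp ?G"
  proof (rule continuous_on_inverse_open_map[OF Ck_on_imp_continuous_on[OF Ck_on_om[of 0 UNIV]] om_surj])
    show "?G (om x) = x" if "x \<in> Lp" for x using om_inj that by simp
    show "openin (top_of_set Mp) (om ` U)" if "openin (top_of_set Lp) U" for U
      by (rule openin_subset_trans[OF openin_om_image[OF that]])
        (use that openin_imp_subset om_in_Mp Mp_subset_V in blast)+
  qed
  show "smooth_map_on V Mp ?G" unfolding smooth_map_on_def
  proof (intro allI Ck_on_om_inverse[OF cont])
    show "?G y \<in> Lp" "om (?G y) = y" if "y \<in> Mp" for y
      using that by (simp_all add: inv_into_into f_inv_into_f flip: om_surj)
  qed
qed

end

section \<open>Trigonometric polynomials on the grid\<close>

lemma subspace_herm_families: "subspace (herm_families idx)"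
  unfolding subspace_def herm_families_def
  by (auto simp: ctranspose_zero ctranspose_add ctranspose_scaleR)

lemma cnj_exp_ii: "cnj (exp (\<i> * of_real r)) = exp (- (\<i> * of_real r))"
  by (simp add: exp_cnj)

lemma freq_pairing_minus: "freq_pairing (- k) \<theta> = - freq_pairing k \<theta>"
  by (simp add: freq_pairing_def sum_negf)

text \<open>Conjugation sends the term of frequency k to that of -k, and \<open>s\<close>, the
  corresponding involution of the index type, permutes the sum.\<close>

lemma ctranspose_trig_poly:
  fixes idx :: "'k::finite \<Rightarrow> int^'d"
  assumes inj: "inj idx" and sym: "\<And>a. - idx a \<in> range idx" and Q: "Q \<in> herm_families idx"
  shows "ctranspose (trig_poly idx Q \<theta>) = trig_poly idx Q \<theta>"
proof -
  define s where "s a = inv idx (- idx a)" for a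
  have s: "idx (s a) = - idx a" for a unfolding s_def by (rule f_inv_into_f[OF sym])
  have "s (s a) = a" for a by (intro injD[OF inj]) (simp add: s)
  then have bij: "bij s" by (rule involuntory_imp_bij)
  have Qs: "Q $ (s a) = ctranspose (Q $ a)" for a using Q s by (simp add: herm_families_def)
  let ?t = "\<lambda>a. mscale (exp (- (\<i> * of_real (freq_pairing (idx a) \<theta>)))) (Q $ a)"
  have "ctranspose (?t a) = ?t (s a)" for a
    by (simp add: ctranspose_mscale s Qs exp_cnj freq_pairing_minus)
  then have "ctranspose (trig_poly idx Q \<theta>) = (\<Sum>a\<in>UNIV. ?t (s a))"
    by (simp add: trig_poly_def ctranspose_sum)
  also have "\<dots> = trig_poly idx Q \<theta>"
    unfolding trig_poly_def by (rule sum.reindex_bij_betw[OF bij, of ?t])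
  finally show ?thesis .
qed

definition moment_summand ::
  "('k::finite \<Rightarrow> int^'d) \<Rightarrow> nat^'d \<Rightarrow> int^'d \<Rightarrow> complex^'m^'m \<Rightarrow> complex^'m^'m^'k" where
  "moment_summand idx N l X = (1 / real (\<Prod>j\<in>UNIV. N $ j)) *\<^sub>R
     (\<chi> a. mscale (exp (\<i> * of_real (freq_pairing (idx a) (grid_point N l)))) X)"

lemma moments_eq_sum:
  "moments idx N \<Phi> = (\<Sum>l\<in>grid_index N. moment_summand idx N l (\<Phi> (grid_point N l)))"
  by (simp add: moments_def moment_summand_def grid_average_def vec_eq_iff scaleR_sum_right)

lemma linear_moment_summand: "linear (moment_summand idx N l)"
  unfolding moment_summand_def
  by (rule linearI)
    (simp_all add: vec_eq_iff linear_add[OF linear_mscale] linear_cmul[OF linear_mscale] scaleR_add_right)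

text \<open>Moving the character across the inner product conjugates it, which turns the sign in the
  moments into the sign in the polynomial.\<close>

lemma moment_summand_inner:
  "moment_summand idx N l X \<bullet> Q
    = (1 / real (\<Prod>j\<in>UNIV. N $ j)) * (X \<bullet> trig_poly idx Q (grid_point N l))"
proof -
  have "(\<chi> a. mscale (exp (\<i> * of_real (freq_pairing (idx a) (grid_point N l)))) X) \<bullet> Q
    = X \<bullet> trig_poly idx Q (grid_point N l)"
    unfolding trig_poly_def inner_sum_right
    by (subst inner_vec_def) (simp only: vec_lambda_beta inner_mscale cnj_exp_ii)
  then show ?thesis by (simp only: moment_summand_def inner_scaleR_left)
qed

lemma moment_summand_herm:
  assumes "ctranspose X = X"
  shows "moment_summand idx N l X \<in> herm_families idx"
  by (simp add: herm_families_def moment_summand_def ctranspose_scaleR ctranspose_mscale assms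
      cnj_exp_ii freq_pairing_minus)

lemma trig_poly_const:
  fixes idx :: "'k::finite \<Rightarrow> int^'d"
  assumes "inj idx" and "idx z = 0"
  shows "trig_poly idx (axis z X) \<theta> = X"
proof -
  have "trig_poly idx (axis z X) \<theta> = (\<Sum>a\<in>UNIV. if a = z then X else 0)"
    unfolding trig_poly_def
    by (rule sum.cong) (auto simp: axis_def assms(2) freq_pairing_def mscale_def vec_eq_iff)
  then show ?thesis by simp
qed

theorem theorem2:
  fixes N :: "nat^'d"
    and \<Lambda> :: "(int^'d) set"
    and idx :: "'k::finite \<Rightarrow> int^'d"
    and \<Psi> :: "real^'d \<Rightarrow> complex^'m^'m"
  assumes "\<And>j. N $ j > 0"
    and "finite \<Lambda>"
    and "0 \<in> \<Lambda>"
    and "\<And>k. k \<in> \<Lambda> \<Longrightarrow> - k \<in> \<Lambda>"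
    and "bij_betw idx UNIV \<Lambda>"
    and "\<And>j. int (N $ j) > 2 * Max {\<bar>k $ j\<bar> | k. k \<in> \<Lambda>}"
    and "\<And>l. l \<in> grid_index N \<Longrightarrow> herm_posdef (\<Psi> (grid_point N l))"
  shows "diffeomorphism_between (herm_families idx) (L_plus idx N \<Psi>)
           (herm_families idx) (M_plus idx N) (omega idx N \<Psi>)"
proof -
  have inj: "inj idx" and range: "range idx = \<Lambda>" using assms(5) by (auto simp: bij_betw_def)
  obtain z where z: "idx z = 0" using assms(3) range by (metis imageE)
  have bound: "2 * \<bar>idx a $ j\<bar> < int (N $ j)" for a j
  proof -
    have "{\<bar>k $ j\<bar> | k. k \<in> \<Lambda>} = (\<lambda>k. \<bar>k $ j\<bar>) ` \<Lambda>" by blast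
    then have "\<bar>idx a $ j\<bar> \<le> Max {\<bar>k $ j\<bar> | k. k \<in> \<Lambda>}"
      using assms(2) range by (intro Max_ge) auto
    then show ?thesis using assms(6)[of j] by linarith
  qed
  \<comment> \<open>Frequencies below N_j / 2 in absolute value differ by less than N_j; this
    excludes aliasing on the grid.\<close>
  have small: "\<bar>idx a $ j - idx b $ j\<bar> < int (N $ j)" for a b j
    using bound[of a j] bound[of b j] by linarith
  interpret M: moment_map "grid_index N" "\<lambda>l Q. trig_poly idx Q (grid_point N l)"
    "moment_summand idx N" "herm_families idx" "\<lambda>l. matrix_inv (\<Psi> (grid_point N l))"
    "axis z (mat 1)" "1 / real (\<Prod>j\<in>UNIV. N $ j)"
  proof (rule moment_map.intro)
    show "0 < 1 / real (\<Prod>j\<in>UNIV. N $ j)" using assms(1) by (simp add: prod_pos)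
    show "(\<Sum>l\<in>grid_index N. moment_summand idx N l (trig_poly idx Q (grid_point N l))) = Q"
      for Q :: "complex^'m^'m^'k"
      using moments_trig_poly[OF assms(1) inj small] by (simp add: moments_eq_sum)
    show "ctranspose (trig_poly idx Q (grid_point N l)) = trig_poly idx Q (grid_point N l)"
      if "Q \<in> herm_families idx" for l and Q :: "complex^'m^'m^'k"
      using assms(4) range that by (intro ctranspose_trig_poly[OF inj]) auto
    show "herm_posdef (matrix_inv (\<Psi> (grid_point N l)))" if "l \<in> grid_index N" for l
      using assms(7)[OF that] by (rule herm_posdef_matrix_inv)
  qed (simp_all only: finite_grid_index linear_trig_poly linear_moment_summand moment_summand_inner
      subspace_herm_families moment_summand_herm trig_poly_const[OF inj z])
  have "L_plus idx N \<Psi> = M.Lp" by (simp add: L_plus_def M.Lp_def M.A_def)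
  moreover have "omega idx N \<Psi> = M.om"
    by (simp add: fun_eq_iff omega_def moments_eq_sum M.om_def M.\<Gamma>_def M.B_def M.A_def)
  moreover have "M_plus idx N = M.Mp"
  proof -
    have "M.\<Gamma> F \<in> M_plus idx N" if F: "\<forall>l\<in>grid_index N. herm_posdef (F l)" for F :: "int^'d \<Rightarrow> complex^'m^'m"
    proof -
      \<comment> \<open>Distinct indices give distinct grid points, so values prescribed on the
        index set can be read as a function of the angle.\<close>
      define \<Phi> where "\<Phi> \<theta> = F (inv_into (grid_index N) (grid_point N) \<theta>)" for \<theta>
      have \<Phi>: "\<Phi> (grid_point N l) = F l" if "l \<in> grid_index N" for l
        using that inj_on_grid_point[OF assms(1)] by (simp add: \<Phi>_def)
      then have "M.\<Gamma> F = moments idx N \<Phi>" by (simp add: moments_eq_sum M.\<Gamma>_def)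
      then show ?thesis using \<Phi> F by (auto simp: M_plus_def)
    qed
    moreover have "moments idx N \<Phi> \<in> M.Mp" if "\<forall>l\<in>grid_index N. herm_posdef (\<Phi> (grid_point N l))" for \<Phi>
      using that by (auto simp: M.Mp_def M.\<Gamma>_def moments_eq_sum)
    ultimately show ?thesis unfolding M_plus_def[of idx N] M.Mp_def M_plus_def by blast
  qed
  ultimately show ?thesis using M.diffeomorphism_om by simp
qed

end
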